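(* Let $n$ be a positive integer, $\delta\in(0,\frac12)$ and $\gamma\in(0,1)$. Let $\rho,\sigma$ be two commuting states on a register of dimension $d\ge2$. Then, in the local error model, there exists an $(n,R,\delta+\gamma)$ blind distribution compression protocol $\mathcal{P}$ for the ensemble consisting of $\rho$ and $\sigma$ (with any prior probabilities) with $$R=2\log\log\Big(\frac d\gamma\Big)+2\log\frac1\delta+3.$$
   Context: All logarithms are base 2; $\Delta(\rho,\sigma)=\frac12\|\rho-\sigma\|_1$ is the trace distance. A map between registers means a completely positive trace preserving linear map. Blind distribution compression (no shared entanglement or shared randomness). For an ensemble $\{p(x),\rho^x_C\}$ of commuting states on a register $C$ of dimension $d$, let $\rho_{XC}=\sum_xp(x)|x\rangle\langle x|_X\otimes\rho^x_C$. Here $x\in\{0,1\}$, $\rho^0_C=\rho$, $\rho^1_C=\sigma$. A Referee and Alice share $n$ copies $\rho_{X_1C_1}\otimes\cdots\otimes\rho_{X_nC_n}$, the Referee holding $X_1,\dots,X_n$ and Alice holding $C_1,\dots,C_n$. In an $(n,R,\varepsilon)$ protocol Alice (who does not have access to $X_1,\dots,X_n$) applies an encoding map from $C_1\cdots C_n$ to $C_1\cdots C_nT$, where $T$ is a classical register of at most $nR$ bits ($|T|\le2^{nR}$), and sends $T$ to Bob, who applies a decoding map from $T$ to $C'_1\cdots C'_n$, each $C_i'$ a copy of $C$. Local error model: for every $i$, the final state $\tau$ satisfies $\Delta(\tau_{X_iC'_i},\rho_{X_iC'_i})\le\varepsilon$, where $\rho_{X_iC_i'}$ is $\rho_{XC}$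 with $C$ replaced by $C'_i$. *)

theory Defs
  imports Complex_Main "Jordan_Normal_Form.Schur_Decomposition"
begin

text \<open>
  An operator on a register with basis labels \<open>{..<a}\<close> is a complex \<open>a \<times> a\<close> matrix. A joint
  register \<open>A B\<close> with dimensions \<open>a\<close> and \<open>b\<close> has basis labels \<open>{..<a * b}\<close>, the pair \<open>(x, y)\<close> being
  encoded as \<open>x * b + y\<close> (the index convention of the Kronecker product). This encoding is
  associative, so \<open>A\<^sub>0 \<dots> A\<^bsub>n-1\<^esub>\<close> consisting of \<open>n\<close> copies of \<open>A\<close> has labels \<open>{..<a ^ n}\<close>, and the
  label of the \<open>j\<close>-th copy is a base-\<open>a\<close> digit, most significant digit first.
\<close>

subsection \<open>States and trace distance\<close>

definition psd :: "nat \<Rightarrow> complex mat \<Rightarrow> bool" where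
  "psd a A \<longleftrightarrow> A \<in> carrier_mat a a \<and> (\<forall>v \<in> carrier_vec a. 0 \<le> (A *\<^sub>v v) \<bullet>c v)"

text \<open>The order on complex numbers is such that \<open>0 \<le> z\<close> includes that \<open>z\<close> is real.\<close>

definition mat_trace :: "complex mat \<Rightarrow> complex" where
  "mat_trace A = (\<Sum>i<dim_row A. A $$ (i, i))"

definition state :: "nat \<Rightarrow> complex mat \<Rightarrow> bool" where
  "state a A \<longleftrightarrow> psd a A \<and> mat_trace A = 1"

definition psd_sqrt :: "complex mat \<Rightarrow> complex mat" where
  "psd_sqrt A = (THE B. psd (dim_row A) B \<and> B * B = A)"

definition trace_norm :: "complex mat \<Rightarrow> real" where
  "trace_norm A = Re (mat_trace (psd_sqrt (mat_adjoint A * A)))"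

definition trace_dist :: "complex mat \<Rightarrow> complex mat \<Rightarrow> real" where
  "trace_dist A B = trace_norm (A - B) / 2"

subsection \<open>Maps between registers\<close>

text \<open>
  \<open>id_tensor k a b \<Phi>\<close> is \<open>id \<otimes> \<Phi>\<close>, where \<open>\<Phi>\<close> maps operators of dimension \<open>a\<close> to operators of
  dimension \<open>b\<close> and the identity acts on operators of dimension \<open>k\<close>: writing the argument as a
  \<open>k \<times> k\<close> block matrix with blocks of size \<open>a \<times> a\<close>, it applies \<open>\<Phi>\<close> to each block.
\<close>

definition block :: "nat \<Rightarrow> complex mat \<Rightarrow> nat \<Rightarrow> nat \<Rightarrow> complex mat" where
  "block a M i j = mat a a (\<lambda>(r, s). M $$ (i * a + r, j * a + s))"

definition id_tensor ::
  "nat \<Rightarrow> nat \<Rightarrow> nat \<Rightarrow> (complex mat \<Rightarrow> complex mat) \<Rightarrow> complex mat \<Rightarrow> complex mat" where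
  "id_tensor k a b \<Phi> M =
     mat (k * b) (k * b) (\<lambda>(u, v). \<Phi> (block a M (u div b) (v div b)) $$ (u mod b, v mod b))"

definition linear_map :: "nat \<Rightarrow> nat \<Rightarrow> (complex mat \<Rightarrow> complex mat) \<Rightarrow> bool" where
  "linear_map a b \<Phi> \<longleftrightarrow>
     (\<forall>A \<in> carrier_mat a a. \<Phi> A \<in> carrier_mat b b) \<and>
     (\<forall>A \<in> carrier_mat a a. \<forall>B \<in> carrier_mat a a. \<Phi> (A + B) = \<Phi> A + \<Phi> B) \<and>
     (\<forall>A \<in> carrier_mat a a. \<forall>c. \<Phi> (c \<cdot>\<^sub>m A) = c \<cdot>\<^sub>m \<Phi> A)"

definition completely_positive :: "nat \<Rightarrow> nat \<Rightarrow> (complex mat \<Rightarrow> complex mat) \<Rightarrow> bool" where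
  "completely_positive a b \<Phi> \<longleftrightarrow> (\<forall>k M. psd (k * a) M \<longrightarrow> psd (k * b) (id_tensor k a b \<Phi> M))"

definition trace_preserving :: "nat \<Rightarrow> (complex mat \<Rightarrow> complex mat) \<Rightarrow> bool" where
  "trace_preserving a \<Phi> \<longleftrightarrow> (\<forall>A \<in> carrier_mat a a. mat_trace (\<Phi> A) = mat_trace A)"

definition cptp :: "nat \<Rightarrow> nat \<Rightarrow> (complex mat \<Rightarrow> complex mat) \<Rightarrow> bool" where
  "cptp a b \<Phi> \<longleftrightarrow> linear_map a b \<Phi> \<and> completely_positive a b \<Phi> \<and> trace_preserving a \<Phi>"

text \<open>
  The second register (of dimension \<open>t\<close>) of the output of \<open>\<Phi>\<close> is classical: every output has the
  form \<open>\<Sum>s. A\<^sub>s \<otimes> |s\<rangle>\<langle>s|\<close>.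
\<close>

definition classical_output ::
  "nat \<Rightarrow> nat \<Rightarrow> nat \<Rightarrow> (complex mat \<Rightarrow> complex mat) \<Rightarrow> bool" where
  "classical_output a b t \<Phi> \<longleftrightarrow>
     (\<forall>A \<in> carrier_mat a a. \<forall>u < b * t. \<forall>v < b * t.
        u mod t \<noteq> v mod t \<longrightarrow> \<Phi> A $$ (u, v) = 0)"

text \<open>
  \<open>trace_out l m r M\<close> is the partial trace of \<open>M\<close>, an operator on three registers of dimensions
  \<open>l\<close>, \<open>m\<close>, \<open>r\<close>, over the middle register.
\<close>

definition trace_out :: "nat \<Rightarrow> nat \<Rightarrow> nat \<Rightarrow> complex mat \<Rightarrow> complex mat" where
  "trace_out l m r M =
     mat (l * r) (l * r) (\<lambda>(u, v).
       \<Sum>k<m. M $$ ((u div r * m + k) * r + u mod r, (v div r * m + k) * r + v mod r))"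

subsection \<open>Blind compression of an ensemble\<close>

text \<open>
  The alphabet of the ensemble is \<open>{..<q}\<close>, and \<open>cq_state q d p \<rho>\<close> is the operator
  \<open>\<Sum>x<q. p x |x\<rangle>\<langle>x| \<otimes> \<rho> x\<close> on the registers \<open>X C\<close> of dimensions \<open>q\<close> and \<open>d\<close>.
\<close>

definition cq_state :: "nat \<Rightarrow> nat \<Rightarrow> (nat \<Rightarrow> real) \<Rightarrow> (nat \<Rightarrow> complex mat) \<Rightarrow> complex mat" where
  "cq_state q d p \<rho> =
     mat (q * d) (q * d) (\<lambda>(u, v).
       if u div d = v div d
       then of_real (p (u div d)) * \<rho> (u div d) $$ (u mod d, v mod d)
       else 0)"

definition digit :: "nat \<Rightarrow> nat \<Rightarrow> nat \<Rightarrow> nat \<Rightarrow> nat" where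
  "digit a n j u = u div a ^ (n - 1 - j) mod a"

text \<open>
  \<open>n\<close> copies of an operator \<open>M\<close> on \<open>X C\<close>, i.e. the tensor product over \<open>j < n\<close> of \<open>M\<close> on
  \<open>X\<^sub>j C\<^sub>j\<close>, with the registers arranged in the order \<open>X\<^sub>0 \<dots> X\<^bsub>n-1\<^esub> C\<^sub>0 \<dots> C\<^bsub>n-1\<^esub>\<close>.
\<close>

definition copies :: "nat \<Rightarrow> nat \<Rightarrow> nat \<Rightarrow> complex mat \<Rightarrow> complex mat" where
  "copies q d n M =
     (let xc = (\<lambda>j u. digit q n j (u div d ^ n) * d + digit d n j (u mod d ^ n))
      in mat (q ^ n * d ^ n) (q ^ n * d ^ n) (\<lambda>(u, v). \<Prod>j<n. M $$ (xc j u, xc j v)))"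

text \<open>
  The encoder \<open>E\<close> maps \<open>C\<^sub>0 \<dots> C\<^bsub>n-1\<^esub>\<close> to \<open>C\<^sub>0 \<dots> C\<^bsub>n-1\<^esub> T\<close>, and the decoder \<open>D\<close> maps \<open>T\<close> to
  \<open>C'\<^sub>0 \<dots> C'\<^bsub>n-1\<^esub>\<close>, where \<open>T\<close> has dimension \<open>t\<close>. The final state lives on the registers
  \<open>X\<^sub>0 \<dots> X\<^bsub>n-1\<^esub> C\<^sub>0 \<dots> C\<^bsub>n-1\<^esub> C'\<^sub>0 \<dots> C'\<^bsub>n-1\<^esub>\<close>.
\<close>

definition final_state ::
  "nat \<Rightarrow> nat \<Rightarrow> nat \<Rightarrow> nat \<Rightarrow> (complex mat \<Rightarrow> complex mat) \<Rightarrow> (complex mat \<Rightarrow> complex mat)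
    \<Rightarrow> complex mat \<Rightarrow> complex mat" where
  "final_state q d n t E D M =
     id_tensor (q ^ n * d ^ n) t (d ^ n) D (id_tensor (q ^ n) (d ^ n) (d ^ n * t) E M)"

text \<open>
  The marginal of the final state on \<open>X\<^sub>i C'\<^sub>i\<close>. Traced out are, in this order, \<open>X\<^sub>0 \<dots> X\<^bsub>i-1\<^esub>\<close>, then
  \<open>X\<^bsub>i+1\<^esub> \<dots> X\<^bsub>n-1\<^esub> C\<^sub>0 \<dots> C\<^bsub>n-1\<^esub> C'\<^sub>0 \<dots> C'\<^bsub>i-1\<^esub>\<close>, and finally \<open>C'\<^bsub>i+1\<^esub> \<dots> C'\<^bsub>n-1\<^esub>\<close>.
\<close>

definition local_marginal :: "nat \<Rightarrow> nat \<Rightarrow> nat \<Rightarrow> nat \<Rightarrow> complex mat \<Rightarrow> complex mat" where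
  "local_marginal q d n i M =
     trace_out (q * d) (d ^ (n - 1 - i)) 1
       (trace_out q (q ^ (n - 1 - i) * d ^ n * d ^ i) (d ^ (n - i))
         (trace_out 1 (q ^ i) (q ^ (n - i) * d ^ n * d ^ n) M))"

text \<open>
  \<open>(t, E, D)\<close> is an \<open>(n, R, \<epsilon>)\<close> blind compression protocol for the ensemble \<open>{p x, \<rho> x}\<close> in the
  local error model. Blindness is built into \<open>final_state\<close>: the encoder acts as the identity on the
  registers \<open>X\<^sub>j\<close>.
\<close>

definition blind_protocol ::
  "nat \<Rightarrow> real \<Rightarrow> real \<Rightarrow> nat \<Rightarrow> nat \<Rightarrow> (nat \<Rightarrow> real) \<Rightarrow> (nat \<Rightarrow> complex mat)
    \<Rightarrow> nat \<Rightarrow> (complex mat \<Rightarrow> complex mat) \<Rightarrow> (complex mat \<Rightarrow> complex mat) \<Rightarrow> bool" where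
  "blind_protocol n R \<epsilon> q d p \<rho> t E D \<longleftrightarrow>
     real t \<le> 2 powr (real n * R) \<and>
     cptp (d ^ n) (d ^ n * t) E \<and> classical_output (d ^ n) (d ^ n) t E \<and>
     cptp t (d ^ n) D \<and>
     (\<forall>i<n. trace_dist
        (local_marginal q d n i (final_state q d n t E D (copies q d n (cq_state q d p \<rho>))))
        (cq_state q d p \<rho>) \<le> \<epsilon>)"

end

theory Submission
  imports Defs
begin

text \<open>
  Let \<open>\<alpha>\<close> and \<open>\<beta>\<close> be the spectra of \<open>\<rho>\<close> and \<open>\<sigma>\<close> in a common eigenbasis. Alice measures each copy in
  this basis and sends the bucket of the outcome \<open>x\<close>, where \<open>[0, 1]\<close> is cut into intervals of length
  \<open>\<delta>\<close> and \<open>x\<close> is put into the interval of \<open>\<alpha> x / (\<alpha> x + \<beta> x)\<close>. Bob samples from \<open>\<alpha> + \<beta>\<close>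
  conditioned on the bucket. On a bucket \<open>\<alpha>\<close> is \<open>\<alpha> + \<beta>\<close> times a factor that varies by at most \<open>\<delta>\<close>,
  and so is \<open>\<beta>\<close>, hence each of the two spectra is reproduced up to
  \<open>\<delta> * (\<Sum>x. \<alpha> x + \<beta> x) = 2 * \<delta>\<close> in \<open>L\<^sup>1\<close>, that is up to \<open>\<delta>\<close> in trace distance. There are at most
  \<open>1 / \<delta> + 1 \<le> 2 / \<delta>\<close> buckets, which is within the rate since \<open>d / \<gamma> \<ge> 2\<close>. Since the protocol is a
  tensor power, every marginal of the final state is the output for a single copy.
\<close>

subsection \<open>Positive semidefinite square roots and the trace norm\<close>

text \<open>Bob does not know which letter occurred, so one resampling law must serve both states.
  The law proportional to \<alpha> + \<beta> dominates both spectra, and since \<beta> / (\<alpha> +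
  \<beta>) = 1 - \<alpha> / (\<alpha> + \<beta>), cutting one ratio into short intervals confines
  the other as well. The error is bounded for each letter separately, so the protocol does not
  depend on the prior: \<open>p\<close> only forms a convex combination of the two errors.

  The rest carries this classical statement to matrices. The trace norm is defined by a definite
  description of a square root, so uniqueness of positive roots has to come before any distance can
  be computed. Commuting states get a common eigenbasis by triangularizing the single normal matrix
  \<open>\<rho> + \<i> \<cdot>\<^sub>m \<sigma>\<close>. Tensor powers are treated entrywise: a
  label of \<open>n\<close> copies is a digit string, and a sum over digit strings of a product over
  positions is a product of sums, which reduces claims on \<open>n\<close> copies to one
  copy.\<close>

lemma dim_mat_adjoint [simp]:
  "dim_row (mat_adjoint A) = dim_col A" "dim_col (mat_adjoint A) = dim_row A"
  by (simp_all add: mat_adjoint_def)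

lemma mat_adjoint_carrier [simp]:
  "A \<in> carrier_mat m n \<Longrightarrow> mat_adjoint A \<in> carrier_mat n m"
  by (intro carrier_matI) auto

lemma mat_adjoint_index [simp]:
  fixes A :: "complex mat"
  assumes "i < dim_col A" "j < dim_row A"
  shows "mat_adjoint A $$ (i, j) = cnj (A $$ (j, i))"
  using assms by (simp add: mat_adjoint_def mat_of_rows_index)

lemma times_mat_index:
  assumes "A \<in> carrier_mat l m" "B \<in> carrier_mat m n" "i < l" "j < n"
  shows "(A * B) $$ (i, j) = (\<Sum>k<m. A $$ (i, k) * B $$ (k, j))"
  using assms by (simp add: scalar_prod_def atLeast0LessThan)

lemma mat_trace_add:
  assumes "A \<in> carrier_mat n n" "B \<in> carrier_mat n n"
  shows "mat_trace (A + B) = mat_trace A + mat_trace B"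
  using assms by (auto simp: mat_trace_def sum.distrib)

lemma mat_trace_comm:
  assumes "A \<in> carrier_mat n n" "B \<in> carrier_mat n n"
  shows "mat_trace (A * B) = mat_trace (B * A)"
proof -
  have "mat_trace (A * B) = (\<Sum>i<n. \<Sum>k<n. A $$ (i, k) * B $$ (k, i))"
    using assms by (simp add: mat_trace_def times_mat_index[OF assms] del: index_mult_mat(1))
  also have "\<dots> = (\<Sum>k<n. \<Sum>i<n. B $$ (k, i) * A $$ (i, k))"
    by (subst sum.swap) (simp add: mult.commute)
  also have "\<dots> = mat_trace (B * A)"
    using assms by (simp add: mat_trace_def times_mat_index[OF assms(2,1)] del: index_mult_mat(1))
  finally show ?thesis .
qed

text \<open>The vector is a plain function, without a carrier, so that test vectors can be written
  down by a formula and sums over joint labels regrouped freely.\<close>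

definition quad :: "nat \<Rightarrow> complex mat \<Rightarrow> (nat \<Rightarrow> complex) \<Rightarrow> complex" where
  "quad a A f = (\<Sum>i<a. \<Sum>j<a. A $$ (i, j) * f j * cnj (f i))"

lemma quad_vec:
  assumes "A \<in> carrier_mat a a" "v \<in> carrier_vec a"
  shows "(A *\<^sub>v v) \<bullet>c v = quad a A (\<lambda>i. v $ i)"
  using assms by (simp add: quad_def scalar_prod_def atLeast0LessThan sum_distrib_right)

lemma psd_iff_quad:
  "psd a A \<longleftrightarrow> A \<in> carrier_mat a a \<and> (\<forall>f. 0 \<le> quad a A f)"
proof -
  have "quad a A f = (A *\<^sub>v vec a f) \<bullet>c vec a f" if "A \<in> carrier_mat a a" for f
    using that by (simp add: quad_vec) (simp add: quad_def)
  moreover have "vec a f \<in> carrier_vec a" for f :: "nat \<Rightarrow> complex"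
    by simp
  ultimately show ?thesis
    unfolding psd_def by (metis quad_vec)
qed

lemma quad_two_point:
  assumes "i < a" "j < a" "i \<noteq> j"
  shows "quad a A (\<lambda>k. if k = i then 1 else if k = j then c else 0) =
    A $$ (i, i) + A $$ (i, j) * c + A $$ (j, i) * cnj c + A $$ (j, j) * (c * cnj c)"
proof -
  have two: "(\<Sum>k<a. h k * (if k = i then 1 else if k = j then e else 0)) = h i + h j * e"
    for h :: "nat \<Rightarrow> complex" and e
  proof -
    have "(\<Sum>k<a. h k * (if k = i then 1 else if k = j then e else 0)) =
      (\<Sum>k<a. (if k = i then h k else 0) + (if k = j then h k * e else 0))"
      using assms by (intro sum.cong) auto
    also have "\<dots> = h i + h j * e"
      using assms by (simp add: sum.distrib)
    finally show ?thesis .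
  qed
  let ?f = "\<lambda>k. if k = i then 1 else if k = j then c else 0 :: complex"
  have "quad a A ?f = (\<Sum>k<a. (\<Sum>l<a. A $$ (k, l) * ?f l) *
      (if k = i then 1 else if k = j then cnj c else 0))"
    unfolding quad_def by (intro sum.cong) (auto simp: sum_distrib_right)
  also have "\<dots> = A $$ (i, i) + A $$ (i, j) * c + (A $$ (j, i) + A $$ (j, j) * c) * cnj c"
    by (simp only: two)
  finally show ?thesis by (simp add: algebra_simps)
qed

lemma quad_one_point:
  assumes "i < a"
  shows "quad a A (\<lambda>k. if k = i then 1 else 0) = A $$ (i, i)"
proof -
  have "(\<Sum>l<a. A $$ (k, l) * (if l = i then 1 else 0) * cnj (if k = i then 1 else 0)) =
      (if k = i then A $$ (i, i) else 0)" for k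
    using assms by (cases "k = i") (simp_all add: if_distrib[where f = "(*) _"] cong: if_cong)
  then show ?thesis
    using assms by (simp add: quad_def)
qed

text \<open>Polarization: the form is real at every vector, in particular at
  \<open>e_i + c e_j\<close> with \<open>c\<close> of modulus one, where the diagonal contributes
  only real terms.\<close>

lemma psd_hermitian:
  assumes "psd a A" "i < a" "j < a"
  shows "A $$ (j, i) = cnj (A $$ (i, j))"
proof -
  have real: "Im (quad a A f) = 0" for f
    using assms(1) unfolding psd_iff_quad by (auto simp: less_eq_complex_def)
  have diag: "Im (A $$ (k, k)) = 0" if "k < a" for k
    using real[of "\<lambda>l. if l = k then 1 else 0"] that by (simp add: quad_one_point)
  show ?thesis
  proof (cases "i = j")
    case True
    then show ?thesis using diag[OF assms(2)] by (simp add: complex_eq_iff)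
  next
    case False
    have "Im (A $$ (i, j) * c + A $$ (j, i) * cnj c) = 0" if "c * cnj c = 1" for c
      using real[of "\<lambda>k. if k = i then 1 else if k = j then c else 0"]
        quad_two_point[OF assms(2,3) False, of A c] diag assms(2,3) that
      by simp
    \<comment> \<open>The value 1 makes the imaginary parts of the two entries opposite, the value
      \<open>\<i>\<close> makes their real parts equal.\<close>
    from this[of 1] this[of \<i>] show ?thesis
      by (simp add: complex_eq_iff)
  qed
qed

text \<open>A zero of a nonnegative form is a minimum. Moving from \<open>f\<close> by
  \<open>t\<close> times \<open>w = B f\<close> changes the form by
  \<open>2 * t * S + t * t * Q\<close>, where \<open>S\<close> is the squared norm of
  \<open>w\<close>; a small negative \<open>t\<close> would make this negative unless
  \<open>S = 0\<close>.\<close>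

lemma psd_quad_zero:
  assumes "psd a B" "quad a B f = 0" "i < a"
  shows "(\<Sum>j<a. B $$ (i, j) * f j) = 0"
proof -
  define w where "w i = (\<Sum>j<a. B $$ (i, j) * f j)" for i
  define S where "S = (\<Sum>i<a. (cmod (w i))\<^sup>2)"
  define Q where "Q = Re (quad a B w)"
  have S: "complex_of_real S = (\<Sum>i<a. w i * cnj (w i))"
    by (simp add: S_def complex_norm_square del: of_real_power)
  have pos: "0 \<le> Re (quad a B g)" for g
    using assms(1) unfolding psd_iff_quad by (auto simp: less_eq_complex_def)
  have cross1: "(\<Sum>i<a. \<Sum>j<a. B $$ (i, j) * f j * cnj (w i)) = of_real S"
    unfolding S by (simp add: w_def sum_distrib_right)
  have "(\<Sum>i<a. \<Sum>j<a. B $$ (i, j) * w j * cnj (f i)) =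
      (\<Sum>j<a. \<Sum>i<a. B $$ (i, j) * w j * cnj (f i))"
    by (rule sum.swap)
  also have "\<dots> = (\<Sum>j<a. \<Sum>i<a. w j * cnj (B $$ (j, i) * f i))"
  proof (intro sum.cong refl)
    fix i j assume "i \<in> {..<a}" "j \<in> {..<a}"
    then have "B $$ (i, j) = cnj (B $$ (j, i))"
      by (intro psd_hermitian[OF assms(1)]) auto
    then show "B $$ (i, j) * w j * cnj (f i) = w j * cnj (B $$ (j, i) * f i)"
      by simp
  qed
  also have "\<dots> = of_real S"
    unfolding S by (simp add: w_def sum_distrib_left)
  finally have cross2: "(\<Sum>i<a. \<Sum>j<a. B $$ (i, j) * w j * cnj (f i)) = of_real S" .
  have expand: "0 \<le> 2 * t * S + t * t * Q" for t :: real
  proof -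
    have "quad a B (\<lambda>i. f i + of_real t * w i) =
      quad a B f + of_real t * (\<Sum>i<a. \<Sum>j<a. B $$ (i, j) * f j * cnj (w i))
      + of_real t * (\<Sum>i<a. \<Sum>j<a. B $$ (i, j) * w j * cnj (f i))
      + of_real (t * t) * quad a B w"
      unfolding quad_def sum_distrib_left sum.distrib[symmetric]
      by (intro sum.cong refl) (simp add: algebra_simps)
    also have "\<dots> = of_real (2 * t * S) + of_real (t * t) * quad a B w"
      by (simp add: cross1 cross2 assms(2))
    finally have "Re (quad a B (\<lambda>i. f i + of_real t * w i)) = 2 * t * S + t * t * Q"
      by (simp add: Q_def)
    then show ?thesis using pos by metis
  qed
  have Q: "0 \<le> Q" unfolding Q_def by (rule pos)
  \<comment> \<open>The minimizer would be \<open>- S / Q\<close>; the shift by 1 covers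
    \<open>Q = 0\<close> and still gives the negative multiple \<open>- (Q + 2) / (Q + 1)^2\<close>
    of the square of \<open>S\<close>.\<close>
  define t where "t = - S / (Q + 1)"
  have t: "t * (Q + 1) = - S" using Q by (simp add: t_def)
  have "0 \<le> (2 * t * S + t * t * Q) * (Q + 1)\<^sup>2"
    by (rule mult_nonneg_nonneg[OF expand]) simp
  also have "\<dots> = 2 * (t * (Q + 1)) * S * (Q + 1) + (t * (Q + 1)) * (t * (Q + 1)) * Q"
    by (simp add: power2_eq_square algebra_simps)
  also have "\<dots> = - (S\<^sup>2 * (Q + 2))"
    unfolding t by (simp add: power2_eq_square algebra_simps)
  finally have "S\<^sup>2 * (Q + 2) \<le> 0" by simp
  then have "S = 0"
    using Q by (simp add: mult_le_0_iff)
  then have "cmod (w i) = 0"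
    using assms(3) unfolding S_def by (subst (asm) sum_nonneg_eq_0_iff) auto
  then show ?thesis by (simp add: w_def)
qed

text \<open>
  With \<open>D = B - C\<close> one has \<open>B D + D C = B\<^sup>2 - C\<^sup>2 = 0\<close>, so the traces of the positive operators
  \<open>D B D\<close> and \<open>D C D\<close> add up to zero. Hence \<open>B D = C D = 0\<close> and \<open>D\<^sup>2 = 0\<close>.
\<close>

lemma psd_sqrt_unique:
  assumes B: "psd a B" and C: "psd a C" and eq: "B * B = C * C"
  shows "B = C"
proof -
  have carr [simp]: "B \<in> carrier_mat a a" "C \<in> carrier_mat a a"
    using B C by (auto simp: psd_def)
  from this[THEN carrier_matD(1)] this[THEN carrier_matD(2)] have dims [simp]: "dim_row B = a" "dim_col B = a" "dim_row C = a" "dim_col C = a"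
    by auto
  define D where "D = B - C"
  have D [simp]: "D \<in> carrier_mat a a" "dim_row D = a" "dim_col D = a"
    by (auto simp: D_def)
  have herm: "cnj (D $$ (i, k)) = D $$ (k, i)" if "i < a" "k < a" for i k
    using that psd_hermitian[OF B that] psd_hermitian[OF C that] by (simp add: D_def)
  have quad_D: "quad a X (\<lambda>j. D $$ (j, k)) = (D * (X * D)) $$ (k, k)"
    if "X \<in> carrier_mat a a" "k < a" for X k
  proof -
    have "(D * (X * D)) $$ (k, k) = (\<Sum>i<a. D $$ (k, i) * (\<Sum>j<a. X $$ (i, j) * D $$ (j, k)))"
      unfolding times_mat_index[OF D(1) mult_carrier_mat[OF that(1) D(1)] that(2,2)]
      by (intro sum.cong refl) (simp only: lessThan_iff times_mat_index[OF that(1) D(1) _ that(2)])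
    also have "\<dots> = quad a X (\<lambda>j. D $$ (j, k))"
      unfolding quad_def using that herm
      by (intro sum.cong) (auto simp: sum_distrib_left ac_simps)
    finally show ?thesis by simp
  qed
  have sum_quad: "(\<Sum>k<a. quad a X (\<lambda>j. D $$ (j, k))) = mat_trace (D * (X * D))"
    if "X \<in> carrier_mat a a" for X
    using that by (simp add: mat_trace_def quad_D)
  have "B * D + D * C = (B * B - B * C) + (B * C - C * C)"
    unfolding D_def using carr
    by (simp add: mult_minus_distrib_mat[of _ a a _ a] minus_mult_distrib_mat[of _ a a _ _ a])
  also have "\<dots> = 0\<^sub>m a a"
    using eq by (intro eq_matI) auto
  finally have zero: "B * D + D * C = 0\<^sub>m a a" .
  \<comment> \<open>Cyclicity of the trace turns \<open>D C D\<close> into \<open>D D C\<close>, so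
    that \<open>D\<close> can be factored out on the left and \<open>zero\<close> applies.\<close>
  have "mat_trace (D * (B * D)) + mat_trace (D * (C * D)) =
      mat_trace (D * (B * D)) + mat_trace (D * (D * C))"
    using mat_trace_comm[of "D * C" a D] by (simp add: assoc_mult_mat[of _ a a _ a _ a])
  also have "\<dots> = mat_trace (D * (B * D + D * C))"
    by (subst mult_add_distrib_mat[of _ a a _ a]) (auto intro!: mat_trace_add[symmetric, of _ a])
  also have "\<dots> = 0"
    unfolding zero by (simp add: right_mult_zero_mat[of _ a a] mat_trace_def)
  finally have tr0: "(\<Sum>k<a. quad a B (\<lambda>j. D $$ (j, k)) + quad a C (\<lambda>j. D $$ (j, k))) = 0"
    by (simp add: sum.distrib sum_quad)
  have pos: "0 \<le> quad a B f" "0 \<le> quad a C f" for f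
    using B C by (auto simp: psd_iff_quad)
  have sum0: "quad a B (\<lambda>j. D $$ (j, k)) + quad a C (\<lambda>j. D $$ (j, k)) = 0" if "k < a" for k
    using tr0 pos that by (subst (asm) sum_nonneg_eq_0_iff) (auto intro: add_nonneg_nonneg)
  have B0: "quad a B (\<lambda>j. D $$ (j, k)) = 0" and C0: "quad a C (\<lambda>j. D $$ (j, k)) = 0"
    if "k < a" for k
    using sum0[OF that] pos by (auto simp: add_nonneg_eq_0_iff)
  have DD: "(\<Sum>j<a. D $$ (k, j) * D $$ (j, k)) = 0" if "k < a" for k
    using psd_quad_zero[OF B B0[OF that] that] psd_quad_zero[OF C C0[OF that] that] that
    by (simp add: D_def left_diff_distrib sum_subtractf)
  have "D $$ (i, k) = 0" if "i < a" "k < a" for i k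
  proof -
    \<comment> \<open>Since \<open>D\<close> is Hermitian, a diagonal entry of its square is the
      squared norm of a column, so vanishing of the diagonal suffices.\<close>
    have "complex_of_real (\<Sum>j<a. (cmod (D $$ (j, k)))\<^sup>2) = (\<Sum>j<a. D $$ (k, j) * D $$ (j, k))"
      using herm that by (auto simp del: of_real_power simp: complex_norm_square ac_simps intro!: sum.cong)
    then have "(\<Sum>j<a. (cmod (D $$ (j, k)))\<^sup>2) = 0"
      using DD[OF that(2)] by (metis of_real_eq_0_iff)
    then show ?thesis
      using that by (subst (asm) sum_nonneg_eq_0_iff) auto
  qed
  then show ?thesis
    by (intro eq_matI) (auto simp: D_def)
qed

lemma psd_sqrt_eqI:
  assumes "psd a B" "B * B = A" "dim_row A = a"
  shows "psd_sqrt A = B"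
  unfolding psd_sqrt_def using assms by (intro the_equality) (auto intro: psd_sqrt_unique)

section \<open>Matrices with a given spectrum in an orthonormal basis\<close>

definition orthonormal :: "nat \<Rightarrow> (nat \<Rightarrow> nat \<Rightarrow> complex) \<Rightarrow> bool" where
  "orthonormal m W \<longleftrightarrow>
     (\<forall>k<m. \<forall>l<m. (\<Sum>r<m. cnj (W r k) * W r l) = (if k = l then 1 else 0))"

text \<open>The product of \<open>W\<close>, the diagonal matrix of \<alpha>, and the adjoint of
  \<open>W\<close>. Negative eigenvalues are allowed because differences of states are to be written
  in this form.\<close>

definition spec_mat ::
  "nat \<Rightarrow> (nat \<Rightarrow> nat \<Rightarrow> complex) \<Rightarrow> (nat \<Rightarrow> real) \<Rightarrow> complex mat" where
  "spec_mat m W \<alpha> = mat m m (\<lambda>(r, s). \<Sum>k<m. of_real (\<alpha> k) * W r k * cnj (W s k))"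

lemma spec_mat_carrier [simp]: "spec_mat m W \<alpha> \<in> carrier_mat m m"
  by (simp add: spec_mat_def)

lemma spec_mat_index:
  "r < m \<Longrightarrow> s < m \<Longrightarrow> spec_mat m W \<alpha> $$ (r, s) = (\<Sum>k<m. of_real (\<alpha> k) * W r k * cnj (W s k))"
  by (simp add: spec_mat_def)

lemma spec_mat_adjoint: "mat_adjoint (spec_mat m W \<alpha>) = spec_mat m W \<alpha>"
  by (intro eq_matI) (auto simp: spec_mat_def ac_simps)

lemma spec_mat_mult:
  assumes "orthonormal m W"
  shows "spec_mat m W \<alpha> * spec_mat m W \<beta> = spec_mat m W (\<lambda>k. \<alpha> k * \<beta> k)"
proof (rule eq_matI)
  fix r s assume "r < dim_row (spec_mat m W (\<lambda>k. \<alpha> k * \<beta> k))"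
    "s < dim_col (spec_mat m W (\<lambda>k. \<alpha> k * \<beta> k))"
  then have rs: "r < m" "s < m" by (auto simp: spec_mat_def)
  have "(spec_mat m W \<alpha> * spec_mat m W \<beta>) $$ (r, s) =
    (\<Sum>t<m. (\<Sum>k<m. of_real (\<alpha> k) * W r k * cnj (W t k)) * (\<Sum>l<m. of_real (\<beta> l) * W t l * cnj (W s l)))"
    using rs by (subst times_mat_index[of _ m m _ m]) (auto simp: spec_mat_index)
  also have "\<dots> = (\<Sum>t<m. \<Sum>k<m. \<Sum>l<m. of_real (\<alpha> k * \<beta> l) * W r k * cnj (W s l) * (cnj (W t k) * W t l))"
    unfolding sum_product by (intro sum.cong refl) simp
  also have "\<dots> = (\<Sum>k<m. \<Sum>t<m. \<Sum>l<m. of_real (\<alpha> k * \<beta> l) * W r k * cnj (W s l) * (cnj (W t k) * W t l))"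
    by (rule sum.swap)
  also have "\<dots> = (\<Sum>k<m. \<Sum>l<m. \<Sum>t<m. of_real (\<alpha> k * \<beta> l) * W r k * cnj (W s l) * (cnj (W t k) * W t l))"
    by (intro sum.cong refl sum.swap)
  also have "\<dots> = (\<Sum>k<m. \<Sum>l<m. of_real (\<alpha> k * \<beta> l) * W r k * cnj (W s l) * (if k = l then 1 else 0))"
    using assms by (intro sum.cong refl) (auto simp: orthonormal_def sum_distrib_left[symmetric])
  also have "\<dots> = (\<Sum>k<m. of_real (\<alpha> k * \<beta> k) * W r k * cnj (W s k))"
    by (simp add: if_distrib[of "(*) _"] cong: if_cong)
  finally show "(spec_mat m W \<alpha> * spec_mat m W \<beta>) $$ (r, s) = spec_mat m W (\<lambda>k. \<alpha> k * \<beta> k) $$ (r, s)"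
    using rs by (simp add: spec_mat_index)
qed (auto simp: spec_mat_def)

text \<open>The modulus is that of the inner product of \<open>f\<close> with the
  \<open>k\<close>-th vector, so signs of the eigenvalues control the sign of the form.\<close>

lemma quad_spec_mat:
  "quad m (spec_mat m W \<alpha>) f =
    (\<Sum>k<m. of_real (\<alpha> k) * of_real ((cmod (\<Sum>r<m. cnj (W r k) * f r))\<^sup>2))"
proof -
  have "quad m (spec_mat m W \<alpha>) f =
    (\<Sum>i<m. \<Sum>j<m. \<Sum>k<m. of_real (\<alpha> k) * ((cnj (W j k) * f j) * cnj (cnj (W i k) * f i)))"
    unfolding quad_def
    by (intro sum.cong refl) (simp add: spec_mat_index sum_distrib_left mult_ac)
  also have "\<dots> = (\<Sum>i<m. \<Sum>k<m. \<Sum>j<m. of_real (\<alpha> k) * ((cnj (W j k) * f j) * cnj (cnj (W i k) * f i)))"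
    by (intro sum.cong refl sum.swap)
  also have "\<dots> = (\<Sum>k<m. \<Sum>i<m. \<Sum>j<m. of_real (\<alpha> k) * ((cnj (W j k) * f j) * cnj (cnj (W i k) * f i)))"
    by (rule sum.swap)
  also have "\<dots> = (\<Sum>k<m. of_real (\<alpha> k) * ((\<Sum>j<m. cnj (W j k) * f j) * cnj (\<Sum>i<m. cnj (W i k) * f i)))"
    unfolding cnj_sum by (subst (2) mult.commute) (simp only: sum_product sum_distrib_left mult.commute)
  also have "\<dots> = (\<Sum>k<m. of_real (\<alpha> k) * of_real ((cmod (\<Sum>r<m. cnj (W r k) * f r))\<^sup>2))"
    by (intro sum.cong refl) (simp only: complex_norm_square)
  finally show ?thesis .
qed

lemma psd_spec_mat:
  assumes "\<And>k. k < m \<Longrightarrow> 0 \<le> \<alpha> k"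
  shows "psd m (spec_mat m W \<alpha>)"
  unfolding psd_iff_quad
proof (intro conjI allI)
  fix f
  have "quad m (spec_mat m W \<alpha>) f =
      of_real (\<Sum>k<m. \<alpha> k * (cmod (\<Sum>r<m. cnj (W r k) * f r))\<^sup>2)"
    unfolding quad_spec_mat of_real_sum of_real_mult ..
  also have "\<dots> \<ge> 0"
    using assms by (auto simp: less_eq_complex_def intro!: sum_nonneg)
  finally show "0 \<le> quad m (spec_mat m W \<alpha>) f" .
qed simp

lemma trace_spec_mat:
  assumes "orthonormal m W"
  shows "mat_trace (spec_mat m W \<alpha>) = of_real (\<Sum>k<m. \<alpha> k)"
proof -
  have "mat_trace (spec_mat m W \<alpha>) = (\<Sum>r<m. \<Sum>k<m. of_real (\<alpha> k) * (cnj (W r k) * W r k))"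
    by (simp add: mat_trace_def spec_mat_def ac_simps)
  also have "\<dots> = (\<Sum>k<m. of_real (\<alpha> k) * (\<Sum>r<m. cnj (W r k) * W r k))"
    by (subst sum.swap) (simp add: sum_distrib_left)
  also have "\<dots> = of_real (\<Sum>k<m. \<alpha> k)"
    using assms by (simp add: orthonormal_def)
  finally show ?thesis .
qed

text \<open>The matrix with eigenvalues \<open>\<bar>\<alpha> k\<bar>\<close> is positive and
  squares to the right thing, so by uniqueness it is the root in the definition of the norm. All
  distances below are evaluated through this formula.\<close>

lemma trace_norm_spec_mat:
  assumes "orthonormal m W"
  shows "trace_norm (spec_mat m W \<alpha>) = (\<Sum>k<m. \<bar>\<alpha> k\<bar>)"
proof -
  have "psd_sqrt (mat_adjoint (spec_mat m W \<alpha>) * spec_mat m W \<alpha>) = spec_mat m W (\<lambda>k. \<bar>\<alpha> k\<bar>)"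
  proof (rule psd_sqrt_eqI)
    show "psd m (spec_mat m W (\<lambda>k. \<bar>\<alpha> k\<bar>))"
      by (rule psd_spec_mat) simp
  qed (simp_all add: spec_mat_adjoint spec_mat_mult[OF assms], simp add: spec_mat_def)
  then show ?thesis
    by (simp add: trace_norm_def trace_spec_mat[OF assms])
qed

subsection \<open>Simultaneous diagonalization\<close>

lemma mat_adjoint_mult:
  fixes A B :: "complex mat"
  assumes "A \<in> carrier_mat l m" "B \<in> carrier_mat m n"
  shows "mat_adjoint (A * B) = mat_adjoint B * mat_adjoint A"
proof (rule eq_matI)
  fix i j assume "i < dim_row (mat_adjoint B * mat_adjoint A)" "j < dim_col (mat_adjoint B * mat_adjoint A)"
  then have ij: "i < n" "j < l" using assms by auto
  have "mat_adjoint (A * B) $$ (i, j) = cnj ((A * B) $$ (j, i))"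
    using assms ij by (subst mat_adjoint_index) auto
  also have "\<dots> = (\<Sum>k<m. cnj (B $$ (k, i)) * cnj (A $$ (j, k)))"
    using assms ij by (subst times_mat_index[of _ l m _ n]) (auto simp: mult.commute)
  also have "\<dots> = (mat_adjoint B * mat_adjoint A) $$ (i, j)"
    using assms ij by (subst times_mat_index[of _ n m _ l]) auto
  finally show "mat_adjoint (A * B) $$ (i, j) = (mat_adjoint B * mat_adjoint A) $$ (i, j)" .
qed (use assms in auto)

text \<open>Gram-Schmidt on a completion of \<open>v\<close> to a basis keeps \<open>v\<close> as
  the first vector; dividing each column by its norm then makes the matrix unitary, with
  \<open>c\<close> the inverse norm of \<open>v\<close>.\<close>

lemma unitary_with_first_column:
  fixes v :: "complex vec"
  assumes v: "v \<in> carrier_vec n" "v \<noteq> 0\<^sub>v n"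
  shows "\<exists>W c. W \<in> carrier_mat n n \<and> mat_adjoint W * W = 1\<^sub>m n \<and> (\<forall>i<n. W $$ (i, 0) = c * v $ i)"
proof -
  interpret cof_vec_space n "TYPE(complex)" .
  define b where "b = basis_completion v"
  define ws where "ws = gram_schmidt n b"
  note bc = basis_completion[OF v, folded b_def]
  have ws: "set ws \<subseteq> carrier_vec n" "corthogonal ws" "length ws = n"
    using gram_schmidt_result[OF bc(2,4,5) ws_def] bc(6) by auto
  have n: "0 < n" using v by (cases n) auto
  obtain vs where "b = v # vs" using bc(6,7) n by (cases b) auto
  then have "hd ws = v"
    unfolding ws_def using gram_schmidt_hd[OF v(1)] by simp
  then have ws0: "ws ! 0 = v" using ws(3) n by (cases ws) auto
  have carr: "ws ! k \<in> carrier_vec n" if "k < n" for k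
    using ws that by auto
  define s where "s k = Re (ws ! k \<bullet>c ws ! k)" for k
  have inner: "ws ! l \<bullet>c ws ! k = (\<Sum>i<n. cnj (ws ! k $ i) * ws ! l $ i)" if "k < n" "l < n" for k l
    using carr[OF that(1)] carr[OF that(2)]
    by (simp add: scalar_prod_def atLeast0LessThan mult.commute)
  have s_of_real: "ws ! k \<bullet>c ws ! k = of_real (s k)" and s_nonneg: "0 \<le> s k" if "k < n" for k
  proof -
    have "ws ! k \<bullet>c ws ! k = of_real (\<Sum>i<n. (cmod (ws ! k $ i))\<^sup>2)"
      unfolding inner[OF that that] of_real_sum complex_norm_square by (simp add: mult.commute)
    then show "ws ! k \<bullet>c ws ! k = of_real (s k)" "0 \<le> s k"
      by (auto simp: s_def intro: sum_nonneg)
  qed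
  have s_pos: "0 < s k" if "k < n" for k
  proof -
    have "ws ! k \<bullet>c ws ! k \<noteq> 0"
      using ws that by (auto simp: corthogonal_def)
    then show ?thesis using s_of_real[OF that] s_nonneg[OF that] by (auto simp: less_le)
  qed
  define W where "W = mat n n (\<lambda>(i, k). ws ! k $ i / of_real (sqrt (s k)))"
  have W: "W \<in> carrier_mat n n" by (simp add: W_def)
  have "mat_adjoint W * W = 1\<^sub>m n"
  proof (rule eq_matI)
    fix k l assume "k < dim_row (1\<^sub>m n :: complex mat)" "l < dim_col (1\<^sub>m n :: complex mat)"
    then have kl: "k < n" "l < n" by auto
    have "(mat_adjoint W * W) $$ (k, l) = (\<Sum>i<n. cnj (W $$ (i, k)) * W $$ (i, l))"
      using W kl by (subst times_mat_index[of _ n n _ n]) auto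
    also have "\<dots> = (\<Sum>i<n. cnj (ws ! k $ i) * ws ! l $ i) / of_real (sqrt (s k) * sqrt (s l))"
      using kl by (simp add: W_def sum_divide_distrib)
    also have "\<dots> = (ws ! l \<bullet>c ws ! k) / of_real (sqrt (s k) * sqrt (s l))"
      using kl by (simp only: inner)
    also have "\<dots> = (if k = l then 1 else 0)"
    proof (cases "k = l")
      case True
      then show ?thesis
        using s_pos[OF kl(1)] by (simp add: s_of_real[OF kl(2)] flip: of_real_mult)
    next
      case False
      then have "ws ! l \<bullet>c ws ! k = 0"
        using ws kl by (auto simp: corthogonal_def)
      then show ?thesis using False by simp
    qed
    finally show "(mat_adjoint W * W) $$ (k, l) = 1\<^sub>m n $$ (k, l)"
      using kl by simp
  qed (use W in auto)
  moreover have "\<forall>i<n. W $$ (i, 0) = (1 / of_real (sqrt (s 0))) * v $ i"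
    using n by (simp add: W_def ws0)
  ultimately show ?thesis using W by blast
qed

lemma mat_adjoint_times_index:
  fixes A :: "complex mat"
  assumes "V \<in> carrier_mat n n" "A \<in> carrier_mat n n" "i < n" "j < n"
  shows "(mat_adjoint V * A * V) $$ (i, j) =
    (\<Sum>l<n. (\<Sum>k<n. cnj (V $$ (k, i)) * A $$ (k, l)) * V $$ (l, j))"
  using assms
  by (subst times_mat_index[of _ n n _ n])
    (auto simp: times_mat_index[of _ n n _ n] simp del: index_mult_mat(1))

text \<open>Schur's induction: a unitary \<open>W\<close> whose first column is an eigenvector
  clears the first column of the conjugate below the diagonal, and the induction hypothesis
  triangularizes the remaining block.\<close>

lemma unitary_schur:
  fixes A :: "complex mat"
  assumes "A \<in> carrier_mat n n"
  shows "\<exists>U \<in> carrier_mat n n. mat_adjoint U * U = 1\<^sub>m n \<and>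
    (\<forall>i<n. \<forall>j<i. (mat_adjoint U * A * U) $$ (i, j) = 0)"
  using assms
proof (induction n arbitrary: A)
  case 0
  then show ?case
    by (intro bexI[of _ "1\<^sub>m 0"]) auto
next
  case (Suc n)
  let ?n = "Suc n"
  have A: "A \<in> carrier_mat ?n ?n" by fact
  have "degree (char_poly A) = ?n"
    using degree_monic_char_poly[OF A] by simp
  then have "\<not> constant (poly (char_poly A))"
    by (simp add: constant_degree)
  then obtain e where "poly (char_poly A) e = 0"
    using fundamental_theorem_of_algebra by blast
  then obtain v where v: "v \<in> carrier_vec ?n" "v \<noteq> 0\<^sub>v ?n" "A *\<^sub>v v = e \<cdot>\<^sub>v v"
    using A eigenvalue_root_char_poly[OF A] by (auto simp: eigenvalue_def eigenvector_def)
  obtain W c where W: "W \<in> carrier_mat ?n ?n" "mat_adjoint W * W = 1\<^sub>m ?n"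
    and W0: "\<And>i. i < ?n \<Longrightarrow> W $$ (i, 0) = c * v $ i"
    using unitary_with_first_column[OF v(1,2)] by blast
  define A' where "A' = mat_adjoint W * A * W"
  have A': "A' \<in> carrier_mat ?n ?n"
    using A W by (auto simp: A'_def)
  have col0: "A' $$ (i, 0) = (if i = 0 then e else 0)" if "i < ?n" for i
  proof -
    have AW: "(A * W) $$ (k, 0) = e * W $$ (k, 0)" if "k < ?n" for k
    proof -
      have "(A * W) $$ (k, 0) = (\<Sum>l<?n. A $$ (k, l) * (c * v $ l))"
        using A W that W0 by (subst times_mat_index[of _ ?n ?n _ ?n]) auto
      also have "\<dots> = c * (A *\<^sub>v v) $ k"
        using A v(1) that
        by (simp add: scalar_prod_def atLeast0LessThan sum_distrib_left ac_simps del: sum.lessThan_Suc)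
      also have "\<dots> = e * W $$ (k, 0)"
        using v that W0 by simp
      finally show ?thesis .
    qed
    have "A' $$ (i, 0) = (mat_adjoint W * (A * W)) $$ (i, 0)"
      using A W by (simp add: A'_def assoc_mult_mat[of _ ?n ?n _ ?n _ ?n])
    also have "\<dots> = (\<Sum>k<?n. mat_adjoint W $$ (i, k) * (e * W $$ (k, 0)))"
      using A W that AW
      by (subst times_mat_index[of _ ?n ?n _ ?n]) (auto simp del: index_mult_mat(1) sum.lessThan_Suc)
    also have "\<dots> = e * (mat_adjoint W * W) $$ (i, 0)"
      using W that
      by (subst times_mat_index[of _ ?n ?n _ ?n])
        (auto simp: sum_distrib_left ac_simps simp del: sum.lessThan_Suc)
    also have "\<dots> = (if i = 0 then e else 0)"
      using W that by simp
    finally show ?thesis .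
  qed
  define B where "B = mat n n (\<lambda>(i, j). A' $$ (Suc i, Suc j))"
  have B: "B \<in> carrier_mat n n" by (simp add: B_def)
  obtain U where U: "U \<in> carrier_mat n n" "mat_adjoint U * U = 1\<^sub>m n"
    and tri: "\<And>i j. i < n \<Longrightarrow> j < i \<Longrightarrow> (mat_adjoint U * B * U) $$ (i, j) = 0"
    using Suc.IH[OF B] by blast
  \<comment> \<open>The smaller unitary bordered by a 1, so that conjugating with it leaves the
    cleared first column alone.\<close>
  define V where "V = mat ?n ?n (\<lambda>(i, j). if i = 0 \<or> j = 0 then if i = j then 1 else 0
    else U $$ (i - 1, j - 1))"
  have V: "V \<in> carrier_mat ?n ?n" by (simp add: V_def)
  have V_simps: "V $$ (0, 0) = 1"
    "i < n \<Longrightarrow> V $$ (Suc i, 0) = 0" "i < n \<Longrightarrow> V $$ (0, Suc i) = 0"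
    "i < n \<Longrightarrow> j < n \<Longrightarrow> V $$ (Suc i, Suc j) = U $$ (i, j)" for i j
    by (auto simp: V_def)
  have "mat_adjoint V * V = 1\<^sub>m ?n"
  proof (rule eq_matI)
    fix i j assume "i < dim_row (1\<^sub>m ?n :: complex mat)" "j < dim_col (1\<^sub>m ?n :: complex mat)"
    then have ij: "i < ?n" "j < ?n" by auto
    have VV: "(mat_adjoint V * V) $$ (i, j) = (\<Sum>k<?n. cnj (V $$ (k, i)) * V $$ (k, j))"
      using V ij by (subst times_mat_index[of _ ?n ?n _ ?n]) (auto simp del: sum.lessThan_Suc)
    show "(mat_adjoint V * V) $$ (i, j) = 1\<^sub>m ?n $$ (i, j)"
    proof (cases "i = 0 \<or> j = 0")
      case True
      then show ?thesis
        unfolding VV using ij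
        by (cases i; cases j) (auto simp: V_simps sum.lessThan_Suc_shift simp del: sum.lessThan_Suc)
    next
      case False
      then obtain i' j' where [simp]: "i = Suc i'" "j = Suc j'"
        by (meson not0_implies_Suc)
      have "(mat_adjoint V * V) $$ (i, j) = (\<Sum>k<n. cnj (U $$ (k, i')) * U $$ (k, j'))"
        unfolding VV using ij
        by (auto simp: V_simps sum.lessThan_Suc_shift simp del: sum.lessThan_Suc)
      also have "\<dots> = (mat_adjoint U * U) $$ (i', j')"
        using U(1) ij by (subst times_mat_index[of _ n n _ n]) auto
      finally show ?thesis
        using U(2) ij by simp
    qed
  qed (use V in auto)
  note V = V this
  have WV: "mat_adjoint (W * V) = mat_adjoint V * mat_adjoint W"
    by (rule mat_adjoint_mult[OF W(1) V(1)])
  show ?case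
  proof (intro bexI conjI allI impI)
    show WV_carr: "W * V \<in> carrier_mat ?n ?n" using W V by auto
    have "mat_adjoint (W * V) * (W * V) = mat_adjoint V * (mat_adjoint W * W * V)"
      unfolding WV using W(1) V(1) by (simp add: assoc_mult_mat[of _ ?n ?n _ ?n _ ?n])
    also have "\<dots> = 1\<^sub>m ?n"
      using W V by simp
    finally show "mat_adjoint (W * V) * (W * V) = 1\<^sub>m ?n" .
  next
    fix i j assume ij: "i < ?n" "j < i"
    then obtain i' where i [simp]: "i = Suc i'" by (cases i) auto
    have "mat_adjoint (W * V) * A * (W * V) = mat_adjoint V * A' * V"
      unfolding WV A'_def using W(1) V(1) A
      by (simp add: assoc_mult_mat[of _ ?n ?n _ ?n _ ?n] mult_carrier_mat[of _ ?n ?n _ ?n])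
    then have eq: "(mat_adjoint (W * V) * A * (W * V)) $$ (i, j) =
        (\<Sum>l<?n. (\<Sum>k<?n. cnj (V $$ (k, i)) * A' $$ (k, l)) * V $$ (l, j))"
      using mat_adjoint_times_index[OF V(1) A'] ij by simp
    \<comment> \<open>In column 0 this is \<open>col0\<close>; in the other columns the zero border
      of \<open>V\<close> removes row and column 0 of \<open>A'\<close> and leaves the triangular
      inner block.\<close>
    show "(mat_adjoint (W * V) * A * (W * V)) $$ (i, j) = 0"
    proof (cases j)
      case 0
      then show ?thesis
        unfolding eq using ij
        by (simp add: V_simps sum.lessThan_Suc_shift col0 del: sum.lessThan_Suc)
    next
      case (Suc j')
      have "(mat_adjoint (W * V) * A * (W * V)) $$ (i, j) =
          (\<Sum>l<n. (\<Sum>k<n. cnj (U $$ (k, i')) * B $$ (k, l)) * U $$ (l, j'))"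
        unfolding eq using ij Suc
        by (simp add: V_simps sum.lessThan_Suc_shift B_def del: sum.lessThan_Suc)
      also have "\<dots> = (mat_adjoint U * B * U) $$ (i', j')"
        using mat_adjoint_times_index[OF U(1) B] ij Suc by simp
      finally show ?thesis
        using tri ij Suc by simp
    qed
  qed
qed

text \<open>For square matrices a left inverse is a right inverse, so orthonormal columns give
  orthonormal rows.\<close>

lemma orthonormal_complete:
  assumes "orthonormal m W" "r < m" "s < m"
  shows "(\<Sum>k<m. W r k * cnj (W s k)) = (if r = s then 1 else 0)"
proof -
  define M where "M = mat m m (\<lambda>(i, j). W i j)"
  have M: "M \<in> carrier_mat m m" by (simp add: M_def)
  have "mat_adjoint M * M = 1\<^sub>m m"
  proof (rule eq_matI)
    fix i j assume "i < dim_row (1\<^sub>m m :: complex mat)" "j < dim_col (1\<^sub>m m :: complex mat)"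
    then show "(mat_adjoint M * M) $$ (i, j) = 1\<^sub>m m $$ (i, j)"
      using assms(1) M
      by (subst times_mat_index[of _ m m _ m]) (auto simp: M_def orthonormal_def)
  qed (use M in auto)
  then have "M * mat_adjoint M = 1\<^sub>m m"
    by (rule mat_mult_left_right_inverse[OF mat_adjoint_carrier[OF M] M])
  then have "(M * mat_adjoint M) $$ (r, s) = 1\<^sub>m m $$ (r, s)" by simp
  then show ?thesis
    using assms M by (subst (asm) times_mat_index[of _ m m _ m]) (auto simp: M_def)
qed

text \<open>Both matrices are packed into \<open>N\<close>, which is normal exactly because its
  Hermitian parts commute. A unitary that triangularizes a normal matrix diagonalizes it, and a
  diagonal matrix has diagonal Hermitian parts.\<close>

lemma simultaneous_diagonalization:
  assumes \<rho>: "psd d \<rho>" and \<sigma>: "psd d \<sigma>" and comm: "\<rho> * \<sigma> = \<sigma> * \<rho>"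
  shows "\<exists>W \<alpha> \<beta>. orthonormal d W \<and> \<rho> = spec_mat d W \<alpha> \<and> \<sigma> = spec_mat d W \<beta> \<and>
    (\<forall>k<d. 0 \<le> \<alpha> k \<and> 0 \<le> \<beta> k)"
proof -
  have carr [simp]: "\<rho> \<in> carrier_mat d d" "\<sigma> \<in> carrier_mat d d"
    using \<rho> \<sigma> by (auto simp: psd_def)
  from carr[THEN carrier_matD(1)] carr[THEN carrier_matD(2)]
  have [simp]: "dim_row \<rho> = d" "dim_col \<rho> = d" "dim_row \<sigma> = d" "dim_col \<sigma> = d"
    by auto
  define N where "N = \<rho> + \<i> \<cdot>\<^sub>m \<sigma>"
  have N: "N \<in> carrier_mat d d" by (simp add: N_def)
  obtain U where U: "U \<in> carrier_mat d d" "mat_adjoint U * U = 1\<^sub>m d"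
    and tri: "\<And>i j. i < d \<Longrightarrow> j < i \<Longrightarrow> (mat_adjoint U * N * U) $$ (i, j) = 0"
    using unitary_schur[OF N] by blast
  have UU: "U * mat_adjoint U = 1\<^sub>m d"
    by (rule mat_mult_left_right_inverse[OF mat_adjoint_carrier[OF U(1)] U])
  define conj_U where "conj_U A = mat_adjoint U * A * U" for A
  have conj_carr: "conj_U A \<in> carrier_mat d d" if "A \<in> carrier_mat d d" for A
    using that U by (auto simp: conj_U_def)
  have conj_index: "conj_U A $$ (i, j) = (\<Sum>l<d. \<Sum>k<d. A $$ (k, l) * U $$ (l, j) * cnj (U $$ (k, i)))"
    if "A \<in> carrier_mat d d" "i < d" "j < d" for A i j
    unfolding conj_U_def mat_adjoint_times_index[OF U(1) that]
    by (simp add: sum_distrib_left mult_ac)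
  have conj_herm: "cnj (conj_U A $$ (i, j)) = conj_U A $$ (j, i)"
    if A: "psd d A" and ij: "i < d" "j < d" for A i j
  proof -
    have [simp]: "A \<in> carrier_mat d d" using A by (simp add: psd_def)
    have "cnj (conj_U A $$ (i, j)) =
        (\<Sum>l<d. \<Sum>k<d. A $$ (l, k) * cnj (U $$ (l, j)) * U $$ (k, i))"
      using ij by (simp add: conj_index psd_hermitian[OF A, symmetric] cong: sum.cong_simp)
    also have "\<dots> = conj_U A $$ (j, i)"
      using ij by (subst sum.swap) (simp add: conj_index ac_simps)
    finally show ?thesis .
  qed
  have conj_diag: "conj_U A $$ (i, i) = quad d A (\<lambda>k. U $$ (k, i))"
    if "A \<in> carrier_mat d d" "i < d" for A i
    using that by (simp add: conj_index quad_def) (rule sum.swap)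
  have conj_mult: "conj_U A * conj_U B = conj_U (A * B)"
    if "A \<in> carrier_mat d d" "B \<in> carrier_mat d d" for A B
  proof -
    have "conj_U A * conj_U B = mat_adjoint U * (A * (U * mat_adjoint U * (B * U)))"
      unfolding conj_U_def using that U(1) by (simp add: assoc_mult_mat[of _ d d _ d _ d] mult_carrier_mat[of _ d d _ d])
    also have "\<dots> = conj_U (A * B)"
      unfolding UU conj_U_def using that U(1) by (simp add: assoc_mult_mat[of _ d d _ d _ d] mult_carrier_mat[of _ d d _ d])
    finally show ?thesis .
  qed
  define R where "R = conj_U \<rho>"
  define S where "S = conj_U \<sigma>"
  define T where "T i j = R $$ (i, j) + \<i> * S $$ (i, j)" for i j
  have RS_carr: "R \<in> carrier_mat d d" "S \<in> carrier_mat d d"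
    by (simp_all add: R_def S_def conj_carr)
  have T_lower: "T i j = 0" if "i < d" "j < i" for i j
  proof -
    have "conj_U N $$ (i, j) = T i j"
      using that N unfolding T_def R_def S_def
      by (simp add: conj_index) (simp add: N_def algebra_simps sum.distrib sum_distrib_left)
    then show ?thesis using tri[OF that] by (simp add: conj_U_def)
  qed
  have RS: "R * S = S * R"
    unfolding R_def S_def by (simp add: conj_mult comm)
  \<comment> \<open>The two sides are the diagonal entries of \<open>T\<close> times its adjoint and
    of the adjoint times \<open>T\<close>; expanded in \<open>R\<close> and \<open>S\<close> they
    differ only in the order of the mixed products.\<close>
  have T_normal: "(\<Sum>k<d. (cmod (T i k))\<^sup>2) = (\<Sum>k<d. (cmod (T k i))\<^sup>2)" if i: "i < d" for i
  proof -
    have cnj_T: "cnj (T k l) = R $$ (l, k) - \<i> * S $$ (l, k)" if "k < d" "l < d" for k l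
      using that conj_herm \<rho> \<sigma> by (simp add: T_def R_def S_def)
    have prod: "(\<Sum>k<d. X $$ (i, k) * Y $$ (k, i)) = (X * Y) $$ (i, i)"
      if "X \<in> carrier_mat d d" "Y \<in> carrier_mat d d" for X Y :: "complex mat"
      using that i by (subst times_mat_index[of _ d d _ d]) auto
    have "(\<Sum>k<d. T i k * cnj (T i k)) = (\<Sum>k<d. R $$ (i, k) * R $$ (k, i) + S $$ (i, k) * S $$ (k, i)
        + \<i> * (S $$ (i, k) * R $$ (k, i)) - \<i> * (R $$ (i, k) * S $$ (k, i)))"
      using i by (intro sum.cong refl) (subst cnj_T; simp add: T_def algebra_simps)
    also have "\<dots> = (\<Sum>k<d. R $$ (i, k) * R $$ (k, i) + S $$ (i, k) * S $$ (k, i)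
        + \<i> * (R $$ (i, k) * S $$ (k, i)) - \<i> * (S $$ (i, k) * R $$ (k, i)))"
      unfolding sum.distrib sum_subtractf sum_distrib_left[symmetric]
      using RS_carr by (simp add: prod RS del: index_mult_mat(1))
    also have "\<dots> = (\<Sum>k<d. T k i * cnj (T k i))"
      using i by (intro sum.cong refl) (subst cnj_T; simp add: T_def algebra_simps)
    finally have "complex_of_real (\<Sum>k<d. (cmod (T i k))\<^sup>2) = complex_of_real (\<Sum>k<d. (cmod (T k i))\<^sup>2)"
      unfolding of_real_sum complex_norm_square .
    then show ?thesis by (simp only: of_real_eq_iff)
  qed
  have T_upper: "T i j = 0" if "i < j" "j < d" for i j
    using that
  proof (induction i arbitrary: j rule: less_induct)
    case (less i)
    \<comment> \<open>Column \<open>i\<close> is zero above the diagonal by the induction hypothesis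
      for earlier rows and below it by triangularity. Equality of the row norm and the column norm
      then leaves nothing off the diagonal in row \<open>i\<close>.\<close>
    have "(\<Sum>k<d. (cmod (T k i))\<^sup>2) = (\<Sum>k\<in>{i}. (cmod (T k i))\<^sup>2)"
    proof (rule sum.mono_neutral_right)
      show "\<forall>k\<in>{..<d} - {i}. (cmod (T k i))\<^sup>2 = 0"
      proof
        fix k assume "k \<in> {..<d} - {i}"
        then show "(cmod (T k i))\<^sup>2 = 0"
          using less.IH[of k i] T_lower[of k i] less.prems by (cases "k < i") auto
      qed
    qed (use less.prems in auto)
    then have "(\<Sum>k<d. (cmod (T i k))\<^sup>2) = (cmod (T i i))\<^sup>2"
      using T_normal[of i] less.prems by simp
    moreover have "(\<Sum>k<d. (cmod (T i k))\<^sup>2) = (cmod (T i i))\<^sup>2 + (\<Sum>k\<in>{..<d} - {i}. (cmod (T i k))\<^sup>2)"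
      using less.prems by (subst sum.remove[of _ i]) auto
    ultimately have "(\<Sum>k\<in>{..<d} - {i}. (cmod (T i k))\<^sup>2) = 0" by simp
    then show ?case
      using less.prems by (subst (asm) sum_nonneg_eq_0_iff) auto
  qed
  have off: "T i j = 0" if "i < d" "j < d" "i \<noteq> j" for i j
    using that T_lower T_upper by (cases "i < j") auto
  have RS_off: "R $$ (i, j) = 0" "S $$ (i, j) = 0" if "i < d" "j < d" "i \<noteq> j" for i j
  proof -
    \<comment> \<open>As \<open>R\<close> and \<open>S\<close> are Hermitian, conjugating the
      transposed entry flips only the sign of the \<open>S\<close> term; sum and difference isolate
      the two parts.\<close>
    have "cnj (T j i) = R $$ (i, j) - \<i> * S $$ (i, j)"
      using that conj_herm \<rho> \<sigma> by (simp add: T_def R_def S_def)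
    then have minus: "R $$ (i, j) - \<i> * S $$ (i, j) = 0"
      using off[of j i] that by simp
    have plus: "R $$ (i, j) + \<i> * S $$ (i, j) = 0"
      using off[of i j] that by (simp add: T_def)
    have "2 * R $$ (i, j) = (R $$ (i, j) + \<i> * S $$ (i, j)) + (R $$ (i, j) - \<i> * S $$ (i, j))"
      by simp
    then show "R $$ (i, j) = 0" unfolding plus minus by simp
    then show "S $$ (i, j) = 0" using plus by simp
  qed
  define W where "W r k = U $$ (r, k)" for r k
  have ortho: "orthonormal d W"
    unfolding orthonormal_def W_def
  proof (intro allI impI)
    fix k l assume "k < d" "l < d"
    then show "(\<Sum>r<d. cnj (U $$ (r, k)) * U $$ (r, l)) = (if k = l then 1 else 0)"
      using arg_cong[OF U(2), of "\<lambda>M. M $$ (k, l)"] U(1)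
      by (subst (asm) times_mat_index[of _ d d _ d]) auto
  qed
  have spec: "A = spec_mat d W (\<lambda>k. Re (conj_U A $$ (k, k)))" and nonneg: "\<And>k. k < d \<Longrightarrow> 0 \<le> Re (conj_U A $$ (k, k))"
    if A: "psd d A" and off: "\<And>i j. i < d \<Longrightarrow> j < d \<Longrightarrow> i \<noteq> j \<Longrightarrow> conj_U A $$ (i, j) = 0" for A
  proof -
    have Ac: "A \<in> carrier_mat d d" using A by (simp add: psd_def)
    have ge: "0 \<le> conj_U A $$ (k, k)" if "k < d" for k
      using A Ac that by (simp add: conj_diag psd_iff_quad)
    then show "0 \<le> Re (conj_U A $$ (k, k))" if "k < d" for k
      using that by (simp add: less_eq_complex_def)
    have real: "of_real (Re (conj_U A $$ (k, k))) = conj_U A $$ (k, k)" if "k < d" for k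
      using ge[OF that] by (simp add: less_eq_complex_def complex_eq_iff)
    have "U * conj_U A * mat_adjoint U = (U * mat_adjoint U) * A * (U * mat_adjoint U)"
      unfolding conj_U_def using U(1) Ac by (simp add: assoc_mult_mat[of _ d d _ d _ d] mult_carrier_mat[of _ d d _ d])
    then have "A = U * conj_U A * mat_adjoint U"
      using Ac by (simp add: UU)
    also have "\<dots> = spec_mat d W (\<lambda>k. Re (conj_U A $$ (k, k)))"
    proof (rule eq_matI)
      fix r s assume "r < dim_row (spec_mat d W (\<lambda>k. Re (conj_U A $$ (k, k))))"
        "s < dim_col (spec_mat d W (\<lambda>k. Re (conj_U A $$ (k, k))))"
      then have rs: "r < d" "s < d" by (auto simp: spec_mat_def)
      have "(U * conj_U A * mat_adjoint U) $$ (r, s) =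
          (\<Sum>l<d. (\<Sum>k<d. U $$ (r, k) * conj_U A $$ (k, l)) * cnj (U $$ (s, l)))"
        using U(1) conj_carr[OF Ac] rs
        by (subst times_mat_index[of _ d d _ d])
          (auto simp: times_mat_index[of _ d d _ d] simp del: index_mult_mat(1))
      also have "\<dots> = (\<Sum>l<d. (\<Sum>k<d. if k = l then U $$ (r, l) * conj_U A $$ (l, l) else 0) * cnj (U $$ (s, l)))"
        using off by (intro sum.cong arg_cong2[where f = "(*)"] refl) auto
      also have "\<dots> = spec_mat d W (\<lambda>k. Re (conj_U A $$ (k, k))) $$ (r, s)"
        using rs real by (simp add: spec_mat_index W_def ac_simps)
      finally show "(U * conj_U A * mat_adjoint U) $$ (r, s) =
          spec_mat d W (\<lambda>k. Re (conj_U A $$ (k, k))) $$ (r, s)" .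
    qed (use U(1) in \<open>auto simp: spec_mat_def\<close>)
    finally show "A = spec_mat d W (\<lambda>k. Re (conj_U A $$ (k, k)))" .
  qed
  show ?thesis
    using ortho spec[OF \<rho>] spec[OF \<sigma>] nonneg[OF \<rho>] nonneg[OF \<sigma>] RS_off
    unfolding R_def S_def by blast
qed

subsection \<open>Digit expansions and partial traces\<close>

lemma sum_lessThan_mult:
  fixes f :: "nat \<Rightarrow> 'a::comm_monoid_add"
  shows "(\<Sum>u<k * b. f u) = (\<Sum>i<k. \<Sum>r<b. f (i * b + r))"
proof -
  have "(\<Sum>u<k * b. f u) = (\<Sum>i<k. sum f {i * b..<i * b + b})"
    by (simp add: sum.nat_group)
  also have "\<dots> = (\<Sum>i<k. \<Sum>r<b. f (i * b + r))"
  proof (rule sum.cong[OF refl])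
    fix i
    show "sum f {i * b..<i * b + b} = (\<Sum>r<b. f (i * b + r))"
      using sum.shift_bounds_nat_ivl[of f 0 "i * b" b]
      by (simp add: atLeast0LessThan add.commute)
  qed
  finally show ?thesis .
qed

lemma mult_add_less:
  fixes i r k b :: nat
  assumes "i < k" "r < b"
  shows "i * b + r < k * b"
proof -
  have "i * b + r < Suc i * b" using assms by simp
  also have "\<dots> \<le> k * b" using assms by (intro mult_le_mono1) simp
  finally show ?thesis .
qed

lemma digit_less: "0 < a \<Longrightarrow> digit a n j u < a"
  by (simp add: digit_def)

lemma digit_Suc:
  assumes "h < a" "l < a ^ n" "j \<le> n"
  shows "digit a (Suc n) j (h * a ^ n + l) = (if j = 0 then h else digit a n (j - 1) l)"
proof (cases j)
  case 0
  have "(h * a ^ n + l) div a ^ n = h"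
    using assms by simp
  then show ?thesis using 0 assms by (simp add: digit_def)
next
  case (Suc j')
  \<comment> \<open>Below the leading position, \<open>h * a ^ n\<close> divided by the place value
    is still a multiple of \<open>a\<close>, so it disappears modulo \<open>a\<close>.\<close>
  then have "n = (n - 1 - j') + Suc j'" using assms(3) by simp
  then have n: "a ^ n = a ^ (n - 1 - j') * (a * a ^ j')"
    by (metis power_Suc power_add)
  have "a ^ (n - 1 - j') \<noteq> 0" using assms(1) by simp
  then have "(l + (h * a ^ j' * a) * a ^ (n - 1 - j')) div a ^ (n - 1 - j') =
      h * a ^ j' * a + l div a ^ (n - 1 - j')"
    by (rule div_mult_self1)
  moreover have "h * a ^ n + l = l + (h * a ^ j' * a) * a ^ (n - 1 - j')"
    unfolding n by (simp add: mult_ac)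
  ultimately have "(h * a ^ n + l) div a ^ (n - 1 - j') = h * a ^ j' * a + l div a ^ (n - 1 - j')"
    by (simp only:)
  then show ?thesis
    using Suc by (simp add: digit_def)
qed

text \<open>Distributivity, by splitting off the leading digit. It is the device by which
  measurement, message and preparation on \<open>n\<close> copies decompose into one-copy
  quantities.\<close>

lemma sum_prod_digits:
  fixes f :: "nat \<Rightarrow> nat \<Rightarrow> 'a::comm_semiring_1"
  shows "(\<Sum>u<a ^ n. \<Prod>j<n. f j (digit a n j u)) = (\<Prod>j<n. \<Sum>c<a. f j c)"
proof (induction n arbitrary: f)
  case 0
  then show ?case by simp
next
  case (Suc n)
  have "(\<Sum>u<a ^ Suc n. \<Prod>j<Suc n. f j (digit a (Suc n) j u)) =
      (\<Sum>h<a. \<Sum>l<a ^ n. \<Prod>j<Suc n. f j (digit a (Suc n) j (h * a ^ n + l)))"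
    unfolding power_Suc by (rule sum_lessThan_mult)
  also have "\<dots> = (\<Sum>h<a. \<Sum>l<a ^ n. f 0 h * (\<Prod>j<n. f (Suc j) (digit a n j l)))"
    by (intro sum.cong refl) (simp add: prod.lessThan_Suc_shift digit_Suc del: prod.lessThan_Suc)
  also have "\<dots> = (\<Sum>h<a. f 0 h) * (\<Prod>j<n. \<Sum>c<a. f (Suc j) c)"
    unfolding sum_distrib_left[symmetric] Suc.IH[of "\<lambda>j. f (Suc j)"] sum_distrib_right ..
  finally show ?case
    by (simp add: prod.lessThan_Suc_shift del: prod.lessThan_Suc)
qed

lemma sum_prod_digits2:
  fixes f :: "nat \<Rightarrow> nat \<Rightarrow> nat \<Rightarrow> 'a::comm_semiring_1"
  shows "(\<Sum>u<a ^ n. \<Sum>v<b ^ n. \<Prod>j<n. f j (digit a n j u) (digit b n j v)) =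
    (\<Prod>j<n. \<Sum>c<a. \<Sum>e<b. f j c e)"
  using sum_prod_digits[of _ b n] sum_prod_digits[of "\<lambda>j c. \<Sum>e<b. f j c e" a n]
  by (simp add: sum_prod_digits[of "\<lambda>j. f j (digit a n j _)" b n])

lemma digit_inject:
  assumes "u < a ^ n" "v < a ^ n" "\<And>j. j < n \<Longrightarrow> digit a n j u = digit a n j v"
  shows "u = v"
  using assms
proof (induction n arbitrary: u v)
  case (Suc n)
  define p where "p = a ^ n"
  have p: "0 < p" using Suc.prems(1) by (cases "a = 0") (auto simp: p_def)
  have split: "w = w div p * a ^ n + w mod p" "w div p < a" "w mod p < a ^ n" if "w < a ^ Suc n" for w
    unfolding p_def[symmetric] using that p by (auto simp: p_def[symmetric] less_mult_imp_div_less)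
  note su = split[OF Suc.prems(1)] and sv = split[OF Suc.prems(2)]
  have dig: "digit a (Suc n) j w = (if j = 0 then w div p else digit a n (j - 1) (w mod p))"
    if "w < a ^ Suc n" "j < Suc n" for w j
    using digit_Suc[OF split(2,3)[OF that(1)], of j] split(1)[OF that(1)] that(2) by simp
  have "u div p = v div p"
    using Suc.prems(3)[of 0] dig[OF Suc.prems(1), of 0] dig[OF Suc.prems(2), of 0] by simp
  moreover have "u mod p = v mod p"
  proof (rule Suc.IH)
    fix j assume "j < n"
    then show "digit a n j (u mod p) = digit a n j (v mod p)"
      using Suc.prems(3)[of "Suc j"] dig[OF Suc.prems(1), of "Suc j"] dig[OF Suc.prems(2), of "Suc j"]
      by simp
  qed (use su sv in auto)
  ultimately show ?case
    by (metis div_mult_mod_eq)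
qed simp

lemma digit_append:
  assumes "k < a ^ i" "m < a ^ l" "j < i + l"
  shows "digit a (i + l) j (k * a ^ l + m) = (if j < i then digit a i j k else digit a l (j - i) m)"
  using assms
proof (induction i arbitrary: k j)
  case (Suc i)
  define p where "p = a ^ i"
  have p: "0 < p" using Suc.prems(1) by (cases "a = 0") (auto simp: p_def)
  have k: "k = k div p * a ^ i + k mod p" "k div p < a" "k mod p < a ^ i"
    unfolding p_def[symmetric] using Suc.prems(1) p
    by (auto simp: p_def[symmetric] less_mult_imp_div_less)
  have less: "k mod p * a ^ l + m < a ^ (i + l)"
    unfolding power_add using k(3) Suc.prems(2) by (rule mult_add_less)
  have j: "j \<le> i + l" using Suc.prems(3) by simp
  have eq: "k * a ^ l + m = k div p * a ^ (i + l) + (k mod p * a ^ l + m)"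
    by (subst k(1)) (simp add: power_add algebra_simps)
  have "digit a (Suc i + l) j (k * a ^ l + m) =
      (if j = 0 then k div p else digit a (i + l) (j - 1) (k mod p * a ^ l + m))"
    unfolding eq add_Suc by (rule digit_Suc[OF k(2) less j])
  also have "\<dots> = (if j = 0 then k div p else if j < Suc i then digit a i (j - 1) (k mod p)
      else digit a l (j - Suc i) m)"
    using Suc.IH[OF k(3) Suc.prems(2), of "j - 1"] Suc.prems(3) by auto
  also have "\<dots> = (if j < Suc i then digit a (Suc i) j k else digit a l (j - Suc i) m)"
    using digit_Suc[OF k(2,3), of j] k(1) by auto
  finally show ?case .
qed simp

lemma prod_digit_delta:
  assumes "\<alpha> < a ^ n" "\<beta> < a ^ n"
  shows "(\<Prod>j<n. if digit a n j \<alpha> = digit a n j \<beta> then 1 else 0) = (if \<alpha> = \<beta> then 1 else (0 :: 'a :: comm_semiring_1))"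
proof (cases "\<alpha> = \<beta>")
  case False
  then obtain j where "j < n" "digit a n j \<alpha> \<noteq> digit a n j \<beta>"
    using digit_inject[OF assms] by blast
  then have "(\<Prod>j<n. if digit a n j \<alpha> = digit a n j \<beta> then 1 else 0) = (0 :: 'a)"
    by (intro prod_zero) auto
  then show ?thesis using False by simp
qed simp

section \<open>Marginals of product operators\<close>

lemma digit_middle:
  assumes "k < a ^ i" "x < a" "m < a ^ l" "j < i + Suc l"
  shows "digit a (i + Suc l) j ((k * a + x) * a ^ l + m) =
    (if j < i then digit a i j k else if j = i then x else digit a l (j - Suc i) m)"
proof -
  have kx: "k * a + x < a ^ Suc i"
    using mult_add_less[OF assms(1,2)] by (simp add: mult.commute)
  have "digit a (i + Suc l) j ((k * a + x) * a ^ l + m) =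
      (if j < Suc i then digit a (Suc i) j (k * a + x) else digit a l (j - Suc i) m)"
    using digit_append[OF kx assms(3), of j] assms(4) by simp
  moreover have "digit a (Suc i) j (k * a + x) = (if j < i then digit a i j k else x)" if "j < Suc i"
    using digit_append[of k a i x 1 j] assms(1,2) that by (simp add: digit_def)
  ultimately show ?thesis by auto
qed

lemma prod_split_middle:
  fixes h :: "nat \<Rightarrow> 'a::comm_monoid_mult"
  shows "(\<Prod>j<i + Suc l. h j) = (\<Prod>j<i. h j) * h i * (\<Prod>j<l. h (i + Suc j))"
  by (induction l) (simp_all add: mult_ac)

lemma trace_out_index:
  assumes "u < l" "v < l" "s < r" "s' < r"
  shows "trace_out l m r M $$ (u * r + s, v * r + s') =
    (\<Sum>k<m. M $$ ((u * m + k) * r + s, (v * m + k) * r + s'))"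
  using assms mult_add_less[OF assms(1,3)] mult_add_less[OF assms(2,4)]
  by (simp add: trace_out_def)

text \<open>Tracing out a copy other than the \<open>i\<close>-th yields the one-copy trace, which
  is 1 by \<open>tr\<close>; the register \<open>C\<close> contributes only its label 0. Hence the
  marginal is the one-copy operator \<open>G\<close>, whatever \<open>i\<close> is.\<close>

lemma local_marginal_product:
  fixes G :: "nat \<Rightarrow> nat \<Rightarrow> nat \<Rightarrow> nat \<Rightarrow> complex"
  assumes "i < n"
    and M: "\<And>X X' C C' c c'. X < q ^ n \<Longrightarrow> X' < q ^ n \<Longrightarrow> C < d ^ n \<Longrightarrow> C' < d ^ n \<Longrightarrow>
      c < d ^ n \<Longrightarrow> c' < d ^ n \<Longrightarrow>
      M $$ ((X * d ^ n + C) * d ^ n + c, (X' * d ^ n + C') * d ^ n + c') =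
      (if C = 0 \<and> C' = 0 then
        \<Prod>j<n. G (digit q n j X) (digit q n j X') (digit d n j c) (digit d n j c') else 0)"
    and tr: "(\<Sum>x<q. \<Sum>c<d. G x x c c) = 1"
    and x: "x < q" "x' < q" and c: "c < d" "c' < d"
  shows "local_marginal q d n i M $$ (x * d + c, x' * d + c') = G x x' c c'"
proof -
  define l where "l = n - 1 - i"
  have n: "n = i + Suc l" using assms(1) by (simp add: l_def)
  have ni: "n - i = Suc l" "n - 1 - i = l" using n by auto
  define r1 where "r1 = q ^ Suc l * d ^ n * d ^ n"
  define m2 where "m2 = q ^ l * d ^ n * d ^ i"
  define N1 where "N1 = trace_out 1 (q ^ i) r1 M"
  define N2 where "N2 = trace_out q m2 (d ^ Suc l) N1"
  have r1: "r1 = q * m2 * d ^ Suc l"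
    by (simp add: r1_def m2_def n power_add mult_ac)
  define u where "u x c = x * d + c" for x c
  have marg: "local_marginal q d n i M = trace_out (q * d) (d ^ l) 1 N2"
    unfolding local_marginal_def ni N1_def N2_def r1_def m2_def ..
  have u: "u x c < q * d" if "x < q" "c < d" for x c
    unfolding u_def using that by (rule mult_add_less)
  \<comment> \<open>The trailing \<open>* 1 + 0\<close> gives the label the shape expected by
    \<open>trace_out_index\<close> for a right register of dimension 1.\<close>
  have "local_marginal q d n i M $$ (u x c * 1 + 0, u x' c' * 1 + 0) =
      (\<Sum>k3<d ^ l. N2 $$ ((u x c * d ^ l + k3) * 1 + 0, (u x' c' * d ^ l + k3) * 1 + 0))"
    unfolding marg using u x c by (intro trace_out_index) auto
  also have "\<dots> = (\<Sum>k3<d ^ l. N2 $$ (x * d ^ Suc l + (c * d ^ l + k3), x' * d ^ Suc l + (c' * d ^ l + k3)))"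
    by (simp add: u_def algebra_simps)
  also have "\<dots> = (\<Sum>k3<d ^ l. \<Sum>k2<m2. N1 $$
      ((x * m2 + k2) * d ^ Suc l + (c * d ^ l + k3), (x' * m2 + k2) * d ^ Suc l + (c' * d ^ l + k3)))"
    unfolding N2_def using x c mult_add_less[of _ d _ "d ^ l"]
    by (intro sum.cong refl trace_out_index) auto
  also have "\<dots> = (\<Sum>k3<d ^ l. \<Sum>k2<m2. \<Sum>k1<q ^ i. M $$
      (k1 * r1 + ((x * m2 + k2) * d ^ Suc l + (c * d ^ l + k3)),
       k1 * r1 + ((x' * m2 + k2) * d ^ Suc l + (c' * d ^ l + k3))))"
  proof (intro sum.cong refl)
    fix k3 k2 assume k: "k3 \<in> {..<d ^ l}" "k2 \<in> {..<m2}"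
    have less: "(x * m2 + k2) * d ^ Suc l + (c * d ^ l + k3) < r1" if "x < q" "c < d" for x c
      unfolding r1 using that k by (intro mult_add_less) (auto intro: mult_add_less)
    show "N1 $$ ((x * m2 + k2) * d ^ Suc l + (c * d ^ l + k3), (x' * m2 + k2) * d ^ Suc l + (c' * d ^ l + k3)) =
      (\<Sum>k1<q ^ i. M $$
      (k1 * r1 + ((x * m2 + k2) * d ^ Suc l + (c * d ^ l + k3)),
       k1 * r1 + ((x' * m2 + k2) * d ^ Suc l + (c' * d ^ l + k3))))"
      using trace_out_index[of 0 1 0 _ r1 _ "q ^ i" M, OF _ _ less[OF x(1) c(1)] less[OF x(2) c(2)]]
      by (simp add: N1_def)
  qed
  also have "\<dots> = (\<Sum>k3<d ^ l. \<Sum>kx<q ^ l. \<Sum>kC<d ^ n. \<Sum>kc<d ^ i. \<Sum>k1<q ^ i. M $$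
      (k1 * r1 + ((x * m2 + ((kx * d ^ n + kC) * d ^ i + kc)) * d ^ Suc l + (c * d ^ l + k3)),
       k1 * r1 + ((x' * m2 + ((kx * d ^ n + kC) * d ^ i + kc)) * d ^ Suc l + (c' * d ^ l + k3))))"
    unfolding m2_def sum_lessThan_mult ..
  also have "\<dots> = (\<Sum>k3<d ^ l. \<Sum>kx<q ^ l. \<Sum>kC<d ^ n. \<Sum>kc<d ^ i. \<Sum>k1<q ^ i.
      if kC = 0 then (\<Prod>j<i. G (digit q i j k1) (digit q i j k1) (digit d i j kc) (digit d i j kc)) *
        G x x' c c' * (\<Prod>j<l. G (digit q l j kx) (digit q l j kx) (digit d l j k3) (digit d l j k3))
      else 0)"
  proof (intro sum.cong refl)
    fix k3 kx kC kc k1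
    assume "k3 \<in> {..<d ^ l}" "kx \<in> {..<q ^ l}" "kC \<in> {..<d ^ n}" "kc \<in> {..<d ^ i}" "k1 \<in> {..<q ^ i}"
    then have k: "k3 < d ^ l" "kx < q ^ l" "kC < d ^ n" "kc < d ^ i" "k1 < q ^ i" by auto
    have X_less: "(k1 * q + x) * q ^ l + kx < q ^ n" if "x < q" for x
      using mult_add_less[OF mult_add_less[OF k(5) that] k(2)] by (simp add: n power_add mult_ac)
    have c_less: "(kc * d + c) * d ^ l + k3 < d ^ n" if "c < d" for c
      using mult_add_less[OF mult_add_less[OF k(4) that] k(1)] by (simp add: n power_add mult_ac)
    \<comment> \<open>The label nested by the three partial traces is regrouped into the order of
      registers in \<open>M\<close>: \<open>k1\<close>, \<open>x\<close>, \<open>kx\<close> make up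
      the string of letters, \<open>kC\<close> labels \<open>C\<close>, and \<open>kc\<close>,
      \<open>c\<close>, \<open>k3\<close> make up Bob's string.\<close>
    have index: "k1 * r1 + ((x * m2 + ((kx * d ^ n + kC) * d ^ i + kc)) * d ^ Suc l + (c * d ^ l + k3)) =
      (((k1 * q + x) * q ^ l + kx) * d ^ n + kC) * d ^ n + ((kc * d + c) * d ^ l + k3)" for x c
      unfolding r1_def m2_def n by (simp add: power_add algebra_simps)
    show "M $$ (k1 * r1 + ((x * m2 + ((kx * d ^ n + kC) * d ^ i + kc)) * d ^ Suc l + (c * d ^ l + k3)),
       k1 * r1 + ((x' * m2 + ((kx * d ^ n + kC) * d ^ i + kc)) * d ^ Suc l + (c' * d ^ l + k3))) =
      (if kC = 0 then (\<Prod>j<i. G (digit q i j k1) (digit q i j k1) (digit d i j kc) (digit d i j kc)) *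
        G x x' c c' * (\<Prod>j<l. G (digit q l j kx) (digit q l j kx) (digit d l j k3) (digit d l j k3))
      else 0)"
      unfolding index M[OF X_less[OF x(1)] X_less[OF x(2)] k(3) k(3) c_less[OF c(1)] c_less[OF c(2)]]
      unfolding n prod_split_middle
      using k x c by (simp add: digit_middle del: add_Suc_right)
  qed
  also have "\<dots> = (\<Sum>k3<d ^ l. \<Sum>kx<q ^ l. \<Sum>kC<d ^ n. if kC = 0 then
      (\<Sum>kc<d ^ i. \<Sum>k1<q ^ i. \<Prod>j<i. G (digit q i j k1) (digit q i j k1) (digit d i j kc) (digit d i j kc)) *
        G x x' c c' * (\<Prod>j<l. G (digit q l j kx) (digit q l j kx) (digit d l j k3) (digit d l j k3))
      else 0)"
    by (intro sum.cong refl) (simp add: sum_distrib_right)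
  also have "\<dots> = (\<Sum>k3<d ^ l. \<Sum>kx<q ^ l.
      (\<Sum>kc<d ^ i. \<Sum>k1<q ^ i. \<Prod>j<i. G (digit q i j k1) (digit q i j k1) (digit d i j kc) (digit d i j kc)) *
        G x x' c c' * (\<Prod>j<l. G (digit q l j kx) (digit q l j kx) (digit d l j k3) (digit d l j k3)))"
    using c by simp
  also have "\<dots> = (\<Sum>kc<d ^ i. \<Sum>k1<q ^ i. \<Prod>j<i. G (digit q i j k1) (digit q i j k1) (digit d i j kc) (digit d i j kc)) *
      G x x' c c' *
      (\<Sum>k3<d ^ l. \<Sum>kx<q ^ l. \<Prod>j<l. G (digit q l j kx) (digit q l j kx) (digit d l j k3) (digit d l j k3))"
    by (simp only: sum_distrib_left)
  \<comment> \<open>The two outer factors are the \<open>i\<close>-th and the \<open>l\<close>-th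
    power of the one-copy trace.\<close>
  also have "\<dots> = G x x' c c'"
    unfolding sum_prod_digits2[of "\<lambda>j c x. G x x c c"]
    using tr by (simp add: sum.swap[of "\<lambda>c x. G x x c c"])
  finally show ?thesis by (simp add: u_def)
qed

subsection \<open>Measure-and-prepare channels\<close>

text \<open>On outcome \<open>e\<close>, with effect \<open>c e |w e><w e|\<close>, the pure state
  \<open>|z e><z e|\<close> is prepared. Encoder and decoder are both of this form, so complete
  positivity and trace preservation are proved once. The weight is kept apart from the vectors to
  avoid square roots of transition probabilities.\<close>

definition measure_prepare ::
  "nat \<Rightarrow> nat \<Rightarrow> 'i set \<Rightarrow> ('i \<Rightarrow> real) \<Rightarrow> ('i \<Rightarrow> nat \<Rightarrow> complex) \<Rightarrow> ('i \<Rightarrow> nat \<Rightarrow> complex)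
    \<Rightarrow> complex mat \<Rightarrow> complex mat" where
  "measure_prepare a b I c w z A = mat b b (\<lambda>(r, s). \<Sum>e\<in>I. of_real (c e) *
     (\<Sum>\<alpha><a. \<Sum>\<beta><a. cnj (w e \<alpha>) * A $$ (\<alpha>, \<beta>) * w e \<beta>) * (z e r * cnj (z e s)))"

lemma measure_prepare_index:
  "r < b \<Longrightarrow> s < b \<Longrightarrow> measure_prepare a b I c w z A $$ (r, s) = (\<Sum>e\<in>I. of_real (c e) *
     (\<Sum>\<alpha><a. \<Sum>\<beta><a. cnj (w e \<alpha>) * A $$ (\<alpha>, \<beta>) * w e \<beta>) * (z e r * cnj (z e s)))"
  by (simp add: measure_prepare_def)

lemma linear_map_measure_prepare: "linear_map a b (measure_prepare a b I c w z)"
  unfolding linear_map_def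
proof (intro conjI ballI allI)
  fix A B :: "complex mat" and k assume A: "A \<in> carrier_mat a a"
  show "measure_prepare a b I c w z A \<in> carrier_mat b b"
    by (simp add: measure_prepare_def)
  show "measure_prepare a b I c w z (k \<cdot>\<^sub>m A) = k \<cdot>\<^sub>m measure_prepare a b I c w z A"
  proof (rule eq_matI)
    fix r s assume "r < dim_row (k \<cdot>\<^sub>m measure_prepare a b I c w z A)"
      "s < dim_col (k \<cdot>\<^sub>m measure_prepare a b I c w z A)"
    then have rs: "r < b" "s < b" by (auto simp: measure_prepare_def)
    have "(\<Sum>\<alpha><a. \<Sum>\<beta><a. cnj (w e \<alpha>) * (k \<cdot>\<^sub>m A) $$ (\<alpha>, \<beta>) * w e \<beta>) =
        k * (\<Sum>\<alpha><a. \<Sum>\<beta><a. cnj (w e \<alpha>) * A $$ (\<alpha>, \<beta>) * w e \<beta>)" for e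
      using A by (simp add: sum_distrib_left mult_ac)
    then show "measure_prepare a b I c w z (k \<cdot>\<^sub>m A) $$ (r, s) = (k \<cdot>\<^sub>m measure_prepare a b I c w z A) $$ (r, s)"
      using rs by (simp add: measure_prepare_def) (simp add: sum_distrib_left mult_ac)
  qed (simp_all add: measure_prepare_def)
  assume B: "B \<in> carrier_mat a a"
  show "measure_prepare a b I c w z (A + B) = measure_prepare a b I c w z A + measure_prepare a b I c w z B"
  proof (rule eq_matI)
    fix r s assume "r < dim_row (measure_prepare a b I c w z A + measure_prepare a b I c w z B)"
      "s < dim_col (measure_prepare a b I c w z A + measure_prepare a b I c w z B)"
    then have rs: "r < b" "s < b" by (auto simp: measure_prepare_def)
    have "(\<Sum>\<alpha><a. \<Sum>\<beta><a. cnj (w e \<alpha>) * (A + B) $$ (\<alpha>, \<beta>) * w e \<beta>) =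
        (\<Sum>\<alpha><a. \<Sum>\<beta><a. cnj (w e \<alpha>) * A $$ (\<alpha>, \<beta>) * w e \<beta>) +
        (\<Sum>\<alpha><a. \<Sum>\<beta><a. cnj (w e \<alpha>) * B $$ (\<alpha>, \<beta>) * w e \<beta>)" for e
      using A B by (simp add: distrib_left distrib_right sum.distrib)
    then show "measure_prepare a b I c w z (A + B) $$ (r, s) =
        (measure_prepare a b I c w z A + measure_prepare a b I c w z B) $$ (r, s)"
      using rs by (simp add: measure_prepare_def) (simp add: distrib_left distrib_right sum.distrib)
  qed (simp_all add: measure_prepare_def)
qed

lemma id_tensor_index:
  assumes "i < k" "j < k" "r < b" "s < b"
  shows "id_tensor k a b \<Phi> M $$ (i * b + r, j * b + s) = \<Phi> (block a M i j) $$ (r, s)"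
  using assms mult_add_less[of i k r b] mult_add_less[of j k s b]
  by (simp add: id_tensor_def)

lemma block_index:
  "\<alpha> < a \<Longrightarrow> \<beta> < a \<Longrightarrow> block a M i j $$ (\<alpha>, \<beta>) = M $$ (i * a + \<alpha>, j * a + \<beta>)"
  by (simp add: block_def)

lemma quad_blocks:
  "quad (k * a) M f = (\<Sum>i<k. \<Sum>j<k. \<Sum>\<alpha><a. \<Sum>\<beta><a.
     M $$ (i * a + \<alpha>, j * a + \<beta>) * f (j * a + \<beta>) * cnj (f (i * a + \<alpha>)))"
  unfolding quad_def sum_lessThan_mult by (rule sum.cong[OF refl]) (rule sum.swap)

text \<open>The vector on the right is \<open>f\<close> pulled back along the adjoint of the Kraus
  operator \<open>|z e><w e|\<close>, tensored with the identity. Complete positivity follows at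
  once, as every summand is a nonnegative weight times the form of \<open>M\<close>.\<close>

lemma quad_id_tensor_measure_prepare:
  "quad (k * b) (id_tensor k a b (measure_prepare a b I c w z) M) f =
    (\<Sum>e\<in>I. of_real (c e) *
      quad (k * a) M (\<lambda>u. w e (u mod a) * (\<Sum>s<b. cnj (z e s) * f (u div a * b + s))))"
proof -
  define X where "X e i j = (\<Sum>\<alpha><a. \<Sum>\<beta><a.
    cnj (w e \<alpha>) * M $$ (i * a + \<alpha>, j * a + \<beta>) * w e \<beta>)" for e i j
  define Z where "Z e j = (\<Sum>s<b. cnj (z e s) * f (j * b + s))" for e j
  have inner: "(\<Sum>r<b. \<Sum>s<b. (\<Sum>e\<in>I. of_real (c e) * X e i j * (z e r * cnj (z e s))) *
      f (j * b + s) * cnj (f (i * b + r))) = (\<Sum>e\<in>I. of_real (c e) * (X e i j * (cnj (Z e i) * Z e j)))"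
    for i j
  proof -
    have "cnj (Z e i) * Z e j =
        (\<Sum>r<b. \<Sum>s<b. cnj (cnj (z e r) * f (i * b + r)) * (cnj (z e s) * f (j * b + s)))" for e
      unfolding Z_def cnj_sum by (rule sum_product)
    then have "(\<Sum>e\<in>I. of_real (c e) * (X e i j * (cnj (Z e i) * Z e j))) =
        (\<Sum>e\<in>I. \<Sum>r<b. \<Sum>s<b. of_real (c e) * X e i j * (z e r * cnj (z e s)) * f (j * b + s) * cnj (f (i * b + r)))"
      by (intro sum.cong refl) (simp add: sum_distrib_left mult_ac)
    also have "\<dots> = (\<Sum>r<b. \<Sum>e\<in>I. \<Sum>s<b. of_real (c e) * X e i j * (z e r * cnj (z e s)) * f (j * b + s) * cnj (f (i * b + r)))"
      by (rule sum.swap)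
    also have "\<dots> = (\<Sum>r<b. \<Sum>s<b. \<Sum>e\<in>I. of_real (c e) * X e i j * (z e r * cnj (z e s)) * f (j * b + s) * cnj (f (i * b + r)))"
      by (rule sum.cong[OF refl]) (rule sum.swap)
    finally show ?thesis by (simp only: sum_distrib_right)
  qed
  have "quad (k * b) (id_tensor k a b (measure_prepare a b I c w z) M) f =
      (\<Sum>i<k. \<Sum>j<k. \<Sum>r<b. \<Sum>s<b. (\<Sum>e\<in>I. of_real (c e) * X e i j * (z e r * cnj (z e s))) *
      f (j * b + s) * cnj (f (i * b + r)))"
    unfolding quad_blocks
    by (intro sum.cong refl) (simp add: id_tensor_index measure_prepare_index block_index X_def)
  also have "\<dots> = (\<Sum>i<k. \<Sum>j<k. \<Sum>e\<in>I. of_real (c e) * (X e i j * (cnj (Z e i) * Z e j)))"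
    by (simp only: inner)
  also have "\<dots> = (\<Sum>i<k. \<Sum>e\<in>I. \<Sum>j<k. of_real (c e) * (X e i j * (cnj (Z e i) * Z e j)))"
    by (rule sum.cong[OF refl]) (rule sum.swap)
  also have "\<dots> = (\<Sum>e\<in>I. \<Sum>i<k. \<Sum>j<k. of_real (c e) * (X e i j * (cnj (Z e i) * Z e j)))"
    by (rule sum.swap)
  also have "\<dots> = (\<Sum>e\<in>I. of_real (c e) *
      quad (k * a) M (\<lambda>u. w e (u mod a) * (\<Sum>s<b. cnj (z e s) * f (u div a * b + s))))"
  proof (rule sum.cong[OF refl])
    fix e
    have "quad (k * a) M (\<lambda>u. w e (u mod a) * (\<Sum>s<b. cnj (z e s) * f (u div a * b + s))) =
        (\<Sum>i<k. \<Sum>j<k. \<Sum>\<alpha><a. \<Sum>\<beta><a.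
          M $$ (i * a + \<alpha>, j * a + \<beta>) * (w e \<beta> * Z e j) * cnj (w e \<alpha> * Z e i))"
      unfolding quad_blocks by (intro sum.cong refl) (simp add: Z_def)
    also have "\<dots> = (\<Sum>i<k. \<Sum>j<k. X e i j * (cnj (Z e i) * Z e j))"
      unfolding X_def sum_distrib_right by (intro sum.cong refl) simp
    finally show "(\<Sum>i<k. \<Sum>j<k. of_real (c e) * (X e i j * (cnj (Z e i) * Z e j))) = of_real (c e) *
        quad (k * a) M (\<lambda>u. w e (u mod a) * (\<Sum>s<b. cnj (z e s) * f (u div a * b + s)))"
      by (simp only: sum_distrib_left)
  qed
  finally show ?thesis .
qed

lemma completely_positive_measure_prepare:
  assumes "\<And>e. e \<in> I \<Longrightarrow> 0 \<le> c e"
  shows "completely_positive a b (measure_prepare a b I c w z)"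
  unfolding completely_positive_def
proof (intro allI impI)
  fix k M assume M: "psd (k * a) M"
  show "psd (k * b) (id_tensor k a b (measure_prepare a b I c w z) M)"
    unfolding psd_iff_quad quad_id_tensor_measure_prepare
  proof (intro conjI allI sum_nonneg)
    fix f e assume "e \<in> I"
    moreover have "0 \<le> quad (k * a) M g" for g
      using M by (simp add: psd_iff_quad)
    ultimately show "0 \<le> of_real (c e) *
        quad (k * a) M (\<lambda>u. w e (u mod a) * (\<Sum>s<b. cnj (z e s) * f (u div a * b + s)))"
      using assms by (intro mult_nonneg_nonneg) (auto simp: less_eq_complex_def)
  qed (simp add: id_tensor_def)
qed

lemma trace_preserving_measure_prepare:
  assumes z: "\<And>e. e \<in> I \<Longrightarrow> (\<Sum>r<b. z e r * cnj (z e r)) = 1"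
    and w: "\<And>\<alpha> \<beta>. \<alpha> < a \<Longrightarrow> \<beta> < a \<Longrightarrow>
      (\<Sum>e\<in>I. of_real (c e) * (cnj (w e \<alpha>) * w e \<beta>)) = (if \<alpha> = \<beta> then 1 else 0)"
  shows "trace_preserving a (measure_prepare a b I c w z)"
  unfolding trace_preserving_def
proof
  fix A :: "complex mat" assume A: "A \<in> carrier_mat a a"
  define X where "X e = (\<Sum>\<alpha><a. \<Sum>\<beta><a. cnj (w e \<alpha>) * A $$ (\<alpha>, \<beta>) * w e \<beta>)" for e
  have "mat_trace (measure_prepare a b I c w z A) =
      (\<Sum>r<b. \<Sum>e\<in>I. of_real (c e) * X e * (z e r * cnj (z e r)))"
    by (simp add: mat_trace_def measure_prepare_def X_def)
  also have "\<dots> = (\<Sum>e\<in>I. of_real (c e) * X e * (\<Sum>r<b. z e r * cnj (z e r)))"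
    unfolding sum_distrib_left by (rule sum.swap)
  also have "\<dots> = (\<Sum>e\<in>I. \<Sum>\<alpha><a. \<Sum>\<beta><a. A $$ (\<alpha>, \<beta>) * (of_real (c e) * (cnj (w e \<alpha>) * w e \<beta>)))"
    unfolding X_def using z by (intro sum.cong refl) (simp add: sum_distrib_left mult_ac)
  also have "\<dots> = (\<Sum>\<alpha><a. \<Sum>e\<in>I. \<Sum>\<beta><a. A $$ (\<alpha>, \<beta>) * (of_real (c e) * (cnj (w e \<alpha>) * w e \<beta>)))"
    by (rule sum.swap)
  also have "\<dots> = (\<Sum>\<alpha><a. \<Sum>\<beta><a. \<Sum>e\<in>I. A $$ (\<alpha>, \<beta>) * (of_real (c e) * (cnj (w e \<alpha>) * w e \<beta>)))"
    by (rule sum.cong[OF refl]) (rule sum.swap)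
  also have "\<dots> = (\<Sum>\<alpha><a. \<Sum>\<beta><a. A $$ (\<alpha>, \<beta>) * (if \<alpha> = \<beta> then 1 else 0))"
    using w by (intro sum.cong refl) (simp flip: sum_distrib_left)
  also have "\<dots> = mat_trace A"
    using A by (simp add: mat_trace_def if_distrib[where f = "(*) _"] cong: if_cong)
  finally show "mat_trace (measure_prepare a b I c w z A) = mat_trace A" .
qed

subsection \<open>The product protocol\<close>

text \<open>The tensor power of the basis \<open>U\<close>; as in \<open>orthonormal\<close>, the
  second argument numbers the vector and the first its components.\<close>

definition prod_basis :: "nat \<Rightarrow> nat \<Rightarrow> (nat \<Rightarrow> nat \<Rightarrow> complex) \<Rightarrow> nat \<Rightarrow> nat \<Rightarrow> complex" where
  "prod_basis n d U \<alpha> x = (\<Prod>j<n. U (digit d n j \<alpha>) (digit d n j x))"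

text \<open>Independent uses of one stochastic kernel \<open>h\<close>, one per copy.\<close>

definition prod_kernel :: "nat \<Rightarrow> nat \<Rightarrow> nat \<Rightarrow> (nat \<Rightarrow> nat \<Rightarrow> real) \<Rightarrow> nat \<Rightarrow> nat \<Rightarrow> real" where
  "prod_kernel n a b h x y = (\<Prod>j<n. h (digit a n j x) (digit b n j y))"

text \<open>
  The encoder measures in the product basis, sends the outcome through the channel \<open>h\<close>, and leaves
  \<open>|0\<rangle>\<langle>0|\<close> on \<open>C\<close>: the label of the pair \<open>(0, T)\<close> is \<open>T\<close> itself.
\<close>

definition encoder ::
  "nat \<Rightarrow> nat \<Rightarrow> nat \<Rightarrow> (nat \<Rightarrow> nat \<Rightarrow> complex) \<Rightarrow> (nat \<Rightarrow> nat \<Rightarrow> real) \<Rightarrow> complex mat \<Rightarrow> complex mat" where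
  "encoder n d m U h = measure_prepare (d ^ n) (d ^ n * m ^ n) ({..<d ^ n} \<times> {..<m ^ n})
     (\<lambda>(x, T). prod_kernel n d m h x T) (\<lambda>(x, T) \<alpha>. prod_basis n d U \<alpha> x)
     (\<lambda>(x, T) r. if r = T then 1 else 0)"

text \<open>Bob reads \<open>T\<close> in the standard basis, samples \<open>y\<close> from the
  kernel \<open>g\<close> given \<open>T\<close>, and prepares the \<open>y\<close>-th product basis
  vector.\<close>

definition decoder ::
  "nat \<Rightarrow> nat \<Rightarrow> nat \<Rightarrow> (nat \<Rightarrow> nat \<Rightarrow> complex) \<Rightarrow> (nat \<Rightarrow> nat \<Rightarrow> real) \<Rightarrow> complex mat \<Rightarrow> complex mat" where
  "decoder n d m U g = measure_prepare (m ^ n) (d ^ n) ({..<m ^ n} \<times> {..<d ^ n})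
     (\<lambda>(T, y). prod_kernel n m d g T y) (\<lambda>(T, y) \<alpha>. if \<alpha> = T then 1 else 0)
     (\<lambda>(T, y) r. prod_basis n d U r y)"

text \<open>Trace preservation of the encoder asks for a resolution of the identity, a sum over the
  basis vectors at fixed components. It factors over the digits into
  \<open>orthonormal_complete\<close>.\<close>

lemma prod_basis_complete:
  assumes U: "orthonormal d U" and less: "\<alpha> < d ^ n" "\<beta> < d ^ n"
  shows "(\<Sum>x<d ^ n. cnj (prod_basis n d U \<alpha> x) * prod_basis n d U \<beta> x) = (if \<alpha> = \<beta> then 1 else 0)"
proof -
  have "(\<Sum>x<d ^ n. cnj (prod_basis n d U \<alpha> x) * prod_basis n d U \<beta> x) =
      (\<Sum>x<d ^ n. \<Prod>j<n. cnj (U (digit d n j \<alpha>) (digit d n j x)) * U (digit d n j \<beta>) (digit d n j x))"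
    by (simp add: prod_basis_def prod.distrib)
  also have "\<dots> = (\<Prod>j<n. \<Sum>x<d. cnj (U (digit d n j \<alpha>) x) * U (digit d n j \<beta>) x)"
    by (rule sum_prod_digits)
  also have "\<dots> = (\<Prod>j<n. if digit d n j \<alpha> = digit d n j \<beta> then 1 else 0)"
  proof (intro prod.cong refl)
    fix j assume "j \<in> {..<n}"
    then have "0 < d" using less by (cases "d = 0") (auto simp: power_0_left)
    then have "(\<Sum>x<d. U (digit d n j \<beta>) x * cnj (U (digit d n j \<alpha>) x)) =
        (if digit d n j \<beta> = digit d n j \<alpha> then 1 else 0)"
      by (intro orthonormal_complete[OF U] digit_less)
    then show "(\<Sum>x<d. cnj (U (digit d n j \<alpha>) x) * U (digit d n j \<beta>) x) =
        (if digit d n j \<alpha> = digit d n j \<beta> then 1 else 0)"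
      by (simp only: mult.commute[of "cnj _"] eq_commute)
  qed
  also have "\<dots> = (if \<alpha> = \<beta> then 1 else 0)"
    by (rule prod_digit_delta[OF less])
  finally show ?thesis .
qed

lemma prod_basis_norm:
  assumes U: "orthonormal d U" and "0 < d"
  shows "(\<Sum>r<d ^ n. prod_basis n d U r y * cnj (prod_basis n d U r y)) = 1"
proof -
  have "(\<Sum>r<d ^ n. prod_basis n d U r y * cnj (prod_basis n d U r y)) =
      (\<Sum>r<d ^ n. \<Prod>j<n. cnj (U (digit d n j r) (digit d n j y)) * U (digit d n j r) (digit d n j y))"
    by (simp add: prod_basis_def prod.distrib mult.commute)
  also have "\<dots> = (\<Prod>j<n. \<Sum>r<d. cnj (U r (digit d n j y)) * U r (digit d n j y))"
    by (rule sum_prod_digits)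
  also have "\<dots> = 1"
    using U digit_less[OF \<open>0 < d\<close>] by (simp add: orthonormal_def)
  finally show ?thesis .
qed

lemma sum_prod_kernel:
  assumes "\<And>x. x < a \<Longrightarrow> (\<Sum>s<b. h x s) = 1" "0 < a"
  shows "(\<Sum>y<b ^ n. prod_kernel n a b h x y) = 1"
  unfolding prod_kernel_def sum_prod_digits[of "\<lambda>j. h (digit a n j x)"] using assms by (simp add: digit_less)

lemma prod_kernel_nonneg:
  "(\<And>x y. 0 \<le> h x y) \<Longrightarrow> 0 \<le> prod_kernel n a b h x y"
  by (simp add: prod_kernel_def prod_nonneg)

lemma cptp_encoder:
  assumes U: "orthonormal d U" and "0 < d" and h: "\<And>x s. 0 \<le> h x s"
    and h_sum: "\<And>x. x < d \<Longrightarrow> (\<Sum>s<m. h x s) = 1"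
  shows "cptp (d ^ n) (d ^ n * m ^ n) (encoder n d m U h)"
  unfolding cptp_def encoder_def
proof (intro conjI linear_map_measure_prepare completely_positive_measure_prepare
    trace_preserving_measure_prepare)
  fix e assume "e \<in> {..<d ^ n} \<times> {..<m ^ n}"
  then obtain x T where e: "e = (x, T)" "x < d ^ n" "T < m ^ n" by auto
  show "0 \<le> (case e of (x, T) \<Rightarrow> prod_kernel n d m h x T)"
    using h by (simp add: e prod_kernel_nonneg)
  \<comment> \<open>The label of the pair \<open>(0, T)\<close> must lie in the output register, or
    the prepared vector would be zero there instead of a unit vector.\<close>
  have "T < d ^ n * m ^ n"
    using mult_add_less[of 0 "d ^ n" T "m ^ n"] e \<open>0 < d\<close> by simp
  then show "(\<Sum>r<d ^ n * m ^ n. (case e of (x, T) \<Rightarrow> \<lambda>r. if r = T then 1 else 0) r *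
      cnj ((case e of (x, T) \<Rightarrow> \<lambda>r. if r = T then 1 else 0) r)) = 1"
    by (simp add: e if_distrib[where f = cnj] if_distrib[where f = "(*) _"] cong: if_cong)
next
  fix \<alpha> \<beta> assume less: "\<alpha> < d ^ n" "\<beta> < d ^ n"
  have "(\<Sum>e\<in>{..<d ^ n} \<times> {..<m ^ n}. of_real (case e of (x, T) \<Rightarrow> prod_kernel n d m h x T) *
      (cnj ((case e of (x, T) \<Rightarrow> \<lambda>\<alpha>. prod_basis n d U \<alpha> x) \<alpha>) *
        (case e of (x, T) \<Rightarrow> \<lambda>\<alpha>. prod_basis n d U \<alpha> x) \<beta>)) =
      (\<Sum>x<d ^ n. \<Sum>T<m ^ n. of_real (prod_kernel n d m h x T) *
        (cnj (prod_basis n d U \<alpha> x) * prod_basis n d U \<beta> x))"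
    by (simp add: sum.cartesian_product')
  also have "\<dots> = (\<Sum>x<d ^ n. of_real (\<Sum>T<m ^ n. prod_kernel n d m h x T) *
        (cnj (prod_basis n d U \<alpha> x) * prod_basis n d U \<beta> x))"
    unfolding of_real_sum sum_distrib_right ..
  also have "\<dots> = (if \<alpha> = \<beta> then 1 else 0)"
    by (simp add: sum_prod_kernel[OF h_sum \<open>0 < d\<close>] prod_basis_complete[OF U less])
  finally show "(\<Sum>e\<in>{..<d ^ n} \<times> {..<m ^ n}. of_real (case e of (x, T) \<Rightarrow> prod_kernel n d m h x T) *
      (cnj ((case e of (x, T) \<Rightarrow> \<lambda>\<alpha>. prod_basis n d U \<alpha> x) \<alpha>) *
        (case e of (x, T) \<Rightarrow> \<lambda>\<alpha>. prod_basis n d U \<alpha> x) \<beta>)) = (if \<alpha> = \<beta> then 1 else 0)" .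
qed

lemma cptp_decoder:
  assumes U: "orthonormal d U" and "0 < d" "0 < m" and g: "\<And>s y. 0 \<le> g s y"
    and g_sum: "\<And>s. s < m \<Longrightarrow> (\<Sum>y<d. g s y) = 1"
  shows "cptp (m ^ n) (d ^ n) (decoder n d m U g)"
  unfolding cptp_def decoder_def
proof (intro conjI linear_map_measure_prepare completely_positive_measure_prepare
    trace_preserving_measure_prepare)
  fix e assume "e \<in> {..<m ^ n} \<times> {..<d ^ n}"
  then obtain T y where e: "e = (T, y)" "T < m ^ n" "y < d ^ n" by auto
  show "0 \<le> (case e of (T, y) \<Rightarrow> prod_kernel n m d g T y)"
    using g by (simp add: e prod_kernel_nonneg)
  show "(\<Sum>r<d ^ n. (case e of (T, y) \<Rightarrow> \<lambda>r. prod_basis n d U r y) r *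
      cnj ((case e of (T, y) \<Rightarrow> \<lambda>r. prod_basis n d U r y) r)) = 1"
    by (simp add: e prod_basis_norm[OF U \<open>0 < d\<close>])
next
  fix \<alpha> \<beta> assume less: "\<alpha> < m ^ n" "\<beta> < m ^ n"
  have "(\<Sum>e\<in>{..<m ^ n} \<times> {..<d ^ n}. of_real (case e of (T, y) \<Rightarrow> prod_kernel n m d g T y) *
      (cnj ((case e of (T, y) \<Rightarrow> \<lambda>\<alpha>. if \<alpha> = T then 1 else 0) \<alpha>) *
        (case e of (T, y) \<Rightarrow> \<lambda>\<alpha>. if \<alpha> = T then 1 else 0) \<beta>)) =
      (\<Sum>T<m ^ n. \<Sum>y<d ^ n. of_real (prod_kernel n m d g T y) *
        (if T = \<alpha> then if \<alpha> = \<beta> then 1 else 0 else 0))"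
    unfolding sum.cartesian_product' by (intro sum.cong refl) auto
  also have "\<dots> = (\<Sum>T<m ^ n. of_real (\<Sum>y<d ^ n. prod_kernel n m d g T y) *
        (if T = \<alpha> then if \<alpha> = \<beta> then 1 else 0 else 0))"
    unfolding of_real_sum sum_distrib_right ..
  also have "\<dots> = (if \<alpha> = \<beta> then 1 else 0)"
    using less by (simp add: sum_prod_kernel[OF g_sum \<open>0 < m\<close>])
  finally show "(\<Sum>e\<in>{..<m ^ n} \<times> {..<d ^ n}. of_real (case e of (T, y) \<Rightarrow> prod_kernel n m d g T y) *
      (cnj ((case e of (T, y) \<Rightarrow> \<lambda>\<alpha>. if \<alpha> = T then 1 else 0) \<alpha>) *
        (case e of (T, y) \<Rightarrow> \<lambda>\<alpha>. if \<alpha> = T then 1 else 0) \<beta>)) = (if \<alpha> = \<beta> then 1 else 0)" .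
qed

text \<open>Every prepared vector is a standard basis vector, so the whole output is diagonal, and
  in particular its part on \<open>T\<close>.\<close>

lemma classical_output_encoder:
  "classical_output (d ^ n) (d ^ n) (m ^ n) (encoder n d m U h)"
  unfolding classical_output_def
proof (intro ballI allI impI)
  fix A :: "complex mat" and u v
  assume "u < d ^ n * m ^ n" "v < d ^ n * m ^ n" "u mod m ^ n \<noteq> v mod m ^ n"
  then show "encoder n d m U h A $$ (u, v) = 0"
    unfolding encoder_def by (subst measure_prepare_index) (auto intro!: sum.neutral)
qed

text \<open>
  The action of the protocol on one copy: \<open>A X X' \<alpha> \<beta>\<close> is the entry \<open>((X, \<alpha>), (X', \<beta>))\<close> of an
  operator on \<open>X C\<close>, the results are indexed in the same way.
\<close>

definition outcome ::
  "nat \<Rightarrow> (nat \<Rightarrow> nat \<Rightarrow> complex) \<Rightarrow> (nat \<Rightarrow> nat \<Rightarrow> nat \<Rightarrow> nat \<Rightarrow> complex) \<Rightarrow> nat \<Rightarrow> nat \<Rightarrow> nat \<Rightarrow> complex" where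
  "outcome d U A X X' x = (\<Sum>\<alpha><d. \<Sum>\<beta><d. cnj (U \<alpha> x) * A X X' \<alpha> \<beta> * U \<beta> x)"

definition message ::
  "nat \<Rightarrow> (nat \<Rightarrow> nat \<Rightarrow> complex) \<Rightarrow> (nat \<Rightarrow> nat \<Rightarrow> real) \<Rightarrow> (nat \<Rightarrow> nat \<Rightarrow> nat \<Rightarrow> nat \<Rightarrow> complex)
    \<Rightarrow> nat \<Rightarrow> nat \<Rightarrow> nat \<Rightarrow> complex" where
  "message d U h A X X' s = (\<Sum>x<d. of_real (h x s) * outcome d U A X X' x)"

definition reconstruction ::
  "nat \<Rightarrow> nat \<Rightarrow> (nat \<Rightarrow> nat \<Rightarrow> complex) \<Rightarrow> (nat \<Rightarrow> nat \<Rightarrow> real) \<Rightarrow> (nat \<Rightarrow> nat \<Rightarrow> real)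
    \<Rightarrow> (nat \<Rightarrow> nat \<Rightarrow> nat \<Rightarrow> nat \<Rightarrow> complex) \<Rightarrow> nat \<Rightarrow> nat \<Rightarrow> nat \<Rightarrow> nat \<Rightarrow> complex" where
  "reconstruction d m U h g A X X' c c' =
    (\<Sum>s<m. \<Sum>y<d. of_real (g s y) * message d U h A X X' s * (U c y * cnj (U c' y)))"

text \<open>Product input, product basis and memoryless kernel factor over the copies. The condition
  \<open>r < m ^ n\<close> says that the \<open>C\<close> part of the label \<open>r\<close> is
  0.\<close>

lemma encoder_product:
  assumes M: "\<And>X X' C C'. X < q ^ n \<Longrightarrow> X' < q ^ n \<Longrightarrow> C < d ^ n \<Longrightarrow> C' < d ^ n \<Longrightarrow>
      M $$ (X * d ^ n + C, X' * d ^ n + C') =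
      (\<Prod>j<n. A (digit q n j X) (digit q n j X') (digit d n j C) (digit d n j C'))"
    and X: "X < q ^ n" "X' < q ^ n" and r: "r < d ^ n * m ^ n" "r' < d ^ n * m ^ n"
  shows "id_tensor (q ^ n) (d ^ n) (d ^ n * m ^ n) (encoder n d m U h) M
      $$ (X * (d ^ n * m ^ n) + r, X' * (d ^ n * m ^ n) + r') =
    (if r = r' \<and> r < m ^ n then
      \<Prod>j<n. message d U h A (digit q n j X) (digit q n j X') (digit m n j r) else 0)"
proof -
  have measured: "(\<Sum>\<alpha><d ^ n. \<Sum>\<beta><d ^ n. cnj (prod_basis n d U \<alpha> x) *
      M $$ (X * d ^ n + \<alpha>, X' * d ^ n + \<beta>) * prod_basis n d U \<beta> x) =
      (\<Prod>j<n. outcome d U A (digit q n j X) (digit q n j X') (digit d n j x))" for x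
  proof -
    have "(\<Sum>\<alpha><d ^ n. \<Sum>\<beta><d ^ n. cnj (prod_basis n d U \<alpha> x) *
        M $$ (X * d ^ n + \<alpha>, X' * d ^ n + \<beta>) * prod_basis n d U \<beta> x) =
      (\<Sum>\<alpha><d ^ n. \<Sum>\<beta><d ^ n. \<Prod>j<n. cnj (U (digit d n j \<alpha>) (digit d n j x)) *
        A (digit q n j X) (digit q n j X') (digit d n j \<alpha>) (digit d n j \<beta>) *
        U (digit d n j \<beta>) (digit d n j x))"
      by (intro sum.cong refl) (simp add: M[OF X] prod_basis_def prod.distrib)
    also have "\<dots> = (\<Prod>j<n. outcome d U A (digit q n j X) (digit q n j X') (digit d n j x))"
      unfolding outcome_def by (rule sum_prod_digits2[of "\<lambda>j \<alpha> \<beta>. cnj (U \<alpha> (digit d n j x)) *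
        A (digit q n j X) (digit q n j X') \<alpha> \<beta> * U \<beta> (digit d n j x)"])
    finally show ?thesis .
  qed
  have sent: "(\<Sum>x<d ^ n. of_real (prod_kernel n d m h x T) *
      (\<Prod>j<n. outcome d U A (digit q n j X) (digit q n j X') (digit d n j x))) =
      (\<Prod>j<n. message d U h A (digit q n j X) (digit q n j X') (digit m n j T))" for T
    unfolding message_def prod_kernel_def of_real_prod prod.distrib[symmetric]
    by (rule sum_prod_digits)
  have "id_tensor (q ^ n) (d ^ n) (d ^ n * m ^ n) (encoder n d m U h) M
      $$ (X * (d ^ n * m ^ n) + r, X' * (d ^ n * m ^ n) + r') =
    (\<Sum>x<d ^ n. \<Sum>T<m ^ n. of_real (prod_kernel n d m h x T) *
      (\<Sum>\<alpha><d ^ n. \<Sum>\<beta><d ^ n. cnj (prod_basis n d U \<alpha> x) *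
      M $$ (X * d ^ n + \<alpha>, X' * d ^ n + \<beta>) * prod_basis n d U \<beta> x) *
      ((if r = T then 1 else 0) * cnj (if r' = T then 1 else 0)))"
    unfolding encoder_def id_tensor_index[OF X r] measure_prepare_index[OF r] sum.cartesian_product' prod.case
    by (intro sum.cong arg_cong2[where f = "(*)"] refl) (simp add: block_index)
  also have "\<dots> = (\<Sum>T<m ^ n. \<Sum>x<d ^ n. of_real (prod_kernel n d m h x T) *
      (\<Prod>j<n. outcome d U A (digit q n j X) (digit q n j X') (digit d n j x)) *
      ((if r = T then 1 else 0) * cnj (if r' = T then 1 else 0)))"
    unfolding measured by (rule sum.swap)
  also have "\<dots> = (\<Sum>T<m ^ n. (\<Prod>j<n. message d U h A (digit q n j X) (digit q n j X') (digit m n j T)) *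
      ((if r = T then 1 else 0) * cnj (if r' = T then 1 else 0)))"
    unfolding sum_distrib_right[symmetric] sent ..
  also have "\<dots> = (\<Sum>T<m ^ n. if r = T then if r = r' then
      \<Prod>j<n. message d U h A (digit q n j X) (digit q n j X') (digit m n j r) else 0 else 0)"
    by (intro sum.cong refl) auto
  finally show ?thesis by simp
qed

text \<open>The decoder measures \<open>T\<close> in the standard basis, so only entries of the
  encoded operator with the same message on both sides enter, and the sum over messages and samples
  factors by digits.\<close>

lemma final_state_product:
  assumes M: "\<And>X X' C C'. X < q ^ n \<Longrightarrow> X' < q ^ n \<Longrightarrow> C < d ^ n \<Longrightarrow> C' < d ^ n \<Longrightarrow>
      M $$ (X * d ^ n + C, X' * d ^ n + C') =
      (\<Prod>j<n. A (digit q n j X) (digit q n j X') (digit d n j C) (digit d n j C'))"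
    and X: "X < q ^ n" "X' < q ^ n" and C: "C < d ^ n" "C' < d ^ n" and c: "c < d ^ n" "c' < d ^ n"
  shows "final_state q d n (m ^ n) (encoder n d m U h) (decoder n d m U g) M
      $$ ((X * d ^ n + C) * d ^ n + c, (X' * d ^ n + C') * d ^ n + c') =
    (if C = 0 \<and> C' = 0 then \<Prod>j<n. reconstruction d m U h g A
      (digit q n j X) (digit q n j X') (digit d n j c) (digit d n j c') else 0)"
proof -
  define N where "N = id_tensor (q ^ n) (d ^ n) (d ^ n * m ^ n) (encoder n d m U h) M"
  define msg where "msg T = (\<Prod>j<n. message d U h A (digit q n j X) (digit q n j X') (digit m n j T))" for T
  have K: "X * d ^ n + C < q ^ n * d ^ n" "X' * d ^ n + C' < q ^ n * d ^ n"
    using X C by (auto intro: mult_add_less)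
  have N: "N $$ ((X * d ^ n + C) * m ^ n + T, (X' * d ^ n + C') * m ^ n + T) =
      (if C = 0 \<and> C' = 0 then msg T else 0)" if T: "T < m ^ n" for T
  proof -
    have r: "C * m ^ n + T < d ^ n * m ^ n" "C' * m ^ n + T < d ^ n * m ^ n"
      using C T by (auto intro: mult_add_less)
    have index: "(Y * d ^ n + E) * m ^ n + T = Y * (d ^ n * m ^ n) + (E * m ^ n + T)" for Y E
      by (simp add: algebra_simps)
    \<comment> \<open>A combined label below \<open>P\<close> has no \<open>C\<close> part; this
      translates the condition of \<open>encoder_product\<close> back to the separate
      registers.\<close>
    have "C * P + T = C' * P + T \<and> C * P + T < P \<longleftrightarrow> C = 0 \<and> C' = 0" if "T < P" for P
      using that by (cases C) auto
    from this[OF T] have "C * m ^ n + T = C' * m ^ n + T \<and> C * m ^ n + T < m ^ n \<longleftrightarrow> C = 0 \<and> C' = 0" .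
    moreover have "N $$ (X * (d ^ n * m ^ n) + (C * m ^ n + T), X' * (d ^ n * m ^ n) + (C' * m ^ n + T)) =
        (if C * m ^ n + T = C' * m ^ n + T \<and> C * m ^ n + T < m ^ n then msg (C * m ^ n + T) else 0)"
      unfolding N_def msg_def by (rule encoder_product[OF _ X r]) (rule M)
    ultimately show ?thesis
      unfolding index by (cases "C = 0 \<and> C' = 0") (simp_all only: if_True if_False mult_0 add_0)
  qed
  have picked: "(\<Sum>\<alpha><m ^ n. \<Sum>\<beta><m ^ n. cnj (if \<alpha> = T then 1 else 0) *
      block (m ^ n) N (X * d ^ n + C) (X' * d ^ n + C') $$ (\<alpha>, \<beta>) * (if \<beta> = T then 1 else 0)) =
      (if C = 0 \<and> C' = 0 then msg T else 0)" if T: "T < m ^ n" for T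
  proof -
    have "(\<Sum>\<alpha><m ^ n. \<Sum>\<beta><m ^ n. cnj (if \<alpha> = T then 1 else 0) *
        block (m ^ n) N (X * d ^ n + C) (X' * d ^ n + C') $$ (\<alpha>, \<beta>) * (if \<beta> = T then 1 else 0)) =
      (\<Sum>\<alpha><m ^ n. if \<alpha> = T then block (m ^ n) N (X * d ^ n + C) (X' * d ^ n + C') $$ (T, T) else 0)"
    proof (intro sum.cong[OF refl])
      fix \<alpha>
      show "(\<Sum>\<beta><m ^ n. cnj (if \<alpha> = T then 1 else 0) *
          block (m ^ n) N (X * d ^ n + C) (X' * d ^ n + C') $$ (\<alpha>, \<beta>) * (if \<beta> = T then 1 else 0)) =
        (if \<alpha> = T then block (m ^ n) N (X * d ^ n + C) (X' * d ^ n + C') $$ (T, T) else 0)"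
        using T by (cases "\<alpha> = T") (simp_all add: if_distrib[where f = "(*) _"] cong: if_cong)
    qed
    also have "\<dots> = (if C = 0 \<and> C' = 0 then msg T else 0)"
      using T by (simp add: block_index N)
    finally show ?thesis .
  qed
  have "final_state q d n (m ^ n) (encoder n d m U h) (decoder n d m U g) M
      $$ ((X * d ^ n + C) * d ^ n + c, (X' * d ^ n + C') * d ^ n + c') =
    (\<Sum>T<m ^ n. \<Sum>y<d ^ n. of_real (prod_kernel n m d g T y) *
      (\<Sum>\<alpha><m ^ n. \<Sum>\<beta><m ^ n. cnj (if \<alpha> = T then 1 else 0) *
      block (m ^ n) N (X * d ^ n + C) (X' * d ^ n + C') $$ (\<alpha>, \<beta>) * (if \<beta> = T then 1 else 0)) *
      (prod_basis n d U c y * cnj (prod_basis n d U c' y)))"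
    unfolding final_state_def N_def[symmetric] id_tensor_index[OF K c] decoder_def
      measure_prepare_index[OF c] sum.cartesian_product' prod.case ..
  also have "\<dots> = (\<Sum>T<m ^ n. \<Sum>y<d ^ n. if C = 0 \<and> C' = 0 then of_real (prod_kernel n m d g T y) *
      msg T * (prod_basis n d U c y * cnj (prod_basis n d U c' y)) else 0)"
    using picked by (intro sum.cong refl) auto
  also have "\<dots> = (if C = 0 \<and> C' = 0 then \<Sum>T<m ^ n. \<Sum>y<d ^ n. of_real (prod_kernel n m d g T y) *
      msg T * (prod_basis n d U c y * cnj (prod_basis n d U c' y)) else 0)"
    by simp
  also have "(\<Sum>T<m ^ n. \<Sum>y<d ^ n. of_real (prod_kernel n m d g T y) *
      msg T * (prod_basis n d U c y * cnj (prod_basis n d U c' y))) =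
    (\<Sum>T<m ^ n. \<Sum>y<d ^ n. \<Prod>j<n. of_real (g (digit m n j T) (digit d n j y)) *
      message d U h A (digit q n j X) (digit q n j X') (digit m n j T) *
      (U (digit d n j c) (digit d n j y) * cnj (U (digit d n j c') (digit d n j y))))"
    by (simp add: prod_kernel_def msg_def prod_basis_def prod.distrib)
  also have "\<dots> = (\<Prod>j<n. reconstruction d m U h g A
      (digit q n j X) (digit q n j X') (digit d n j c) (digit d n j c'))"
    unfolding reconstruction_def
    by (rule sum_prod_digits2[of "\<lambda>j s y. of_real (g s y) *
      message d U h A (digit q n j X) (digit q n j X') s *
      (U (digit d n j c) y * cnj (U (digit d n j c') y))"])
  finally show ?thesis .
qed

section \<open>Classical-quantum states and the reduction to classical kernels\<close>

lemma cq_state_index: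
  assumes "x < q" "x' < q" "c < d" "c' < d"
  shows "cq_state q d p \<rho> $$ (x * d + c, x' * d + c') =
    (if x = x' then of_real (p x) * \<rho> x $$ (c, c') else 0)"
  using assms mult_add_less[of x q c d] mult_add_less[of x' q c' d]
  by (simp add: cq_state_def)

lemma copies_index:
  assumes "X < q ^ n" "X' < q ^ n" "C < d ^ n" "C' < d ^ n"
  shows "copies q d n M $$ (X * d ^ n + C, X' * d ^ n + C') =
    (\<Prod>j<n. M $$ (digit q n j X * d + digit d n j C, digit q n j X' * d + digit d n j C'))"
proof -
  have "(Y * b + E) div b = Y" if "E < b" for Y E b :: nat
    using that by simp
  from this[OF assms(3)] this[OF assms(4)] show ?thesis
    using assms mult_add_less[OF assms(1,3)] mult_add_less[OF assms(2,4)]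
    by (simp add: copies_def Let_def)
qed

lemma spec_mat_expectation:
  assumes U: "orthonormal d U" and "k < d"
  shows "(\<Sum>\<alpha><d. \<Sum>\<beta><d. cnj (U \<alpha> k) * spec_mat d U \<mu> $$ (\<alpha>, \<beta>) * U \<beta> k) = of_real (\<mu> k)"
proof -
  have "(\<Sum>\<alpha><d. \<Sum>\<beta><d. cnj (U \<alpha> k) * spec_mat d U \<mu> $$ (\<alpha>, \<beta>) * U \<beta> k) =
      quad d (spec_mat d U \<mu>) (\<lambda>\<alpha>. U \<alpha> k)"
    unfolding quad_def by (intro sum.cong refl) simp
  also have "\<dots> = (\<Sum>l<d. if l = k then of_real (\<mu> k) else 0)"
    unfolding quad_spec_mat using U \<open>k < d\<close>
    by (intro sum.cong refl) (auto simp: orthonormal_def)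
  finally show ?thesis using \<open>k < d\<close> by simp
qed

text \<open>These are the vectors of \<open>U\<close> tensored with a standard basis vector of the
  register \<open>X\<close>, a common eigenbasis for all the classical-quantum states that
  occur.\<close>

lemma orthonormal_blocks:
  assumes U: "orthonormal d U"
  shows "orthonormal (q * d) (\<lambda>u k. if u div d = k div d then U (u mod d) (k mod d) else 0)"
  unfolding orthonormal_def
proof (intro allI impI)
  fix k l assume kl: "k < q * d" "l < q * d"
  then have d: "0 < d" by (cases d) auto
  have "(\<Sum>u<q * d. cnj (if u div d = k div d then U (u mod d) (k mod d) else 0) *
      (if u div d = l div d then U (u mod d) (l mod d) else 0)) =
    (\<Sum>x<q. \<Sum>r<d. if x = k div d then if k div d = l div d then
      cnj (U r (k mod d)) * U r (l mod d) else 0 else 0)"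
    unfolding sum_lessThan_mult by (intro sum.cong refl) auto
  also have "\<dots> = (\<Sum>x<q. if x = k div d then if k div d = l div d then
      if k mod d = l mod d then 1 else 0 else 0 else 0)"
    using U d by (intro sum.cong refl) (auto simp: orthonormal_def)
  also have "\<dots> = (if k div d = l div d then if k mod d = l mod d then 1 else 0 else 0)"
    using kl by (simp add: less_mult_imp_div_less)
  also have "\<dots> = (if k = l then 1 else 0)"
    by (metis div_mult_mod_eq)
  finally show "(\<Sum>u<q * d. cnj (if u div d = k div d then U (u mod d) (k mod d) else 0) *
      (if u div d = l div d then U (u mod d) (l mod d) else 0)) = (if k = l then 1 else 0)" .
qed

text \<open>The difference is diagonal in the basis of \<open>orthonormal_blocks\<close>, so its
  trace norm is the absolute sum of the differences of joint probabilities.\<close>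

lemma trace_dist_cq_state:
  assumes U: "orthonormal d U" and p: "\<And>x. x < q \<Longrightarrow> 0 \<le> p x"
  shows "trace_dist (cq_state q d p (\<lambda>x. spec_mat d U (\<mu> x))) (cq_state q d p (\<lambda>x. spec_mat d U (\<nu> x))) =
    (\<Sum>x<q. p x * (\<Sum>y<d. \<bar>\<mu> x y - \<nu> x y\<bar>)) / 2"
proof -
  define W where "W u k = (if u div d = k div d then U (u mod d) (k mod d) else 0)" for u k
  define \<eta> where "\<eta> k = p (k div d) * (\<mu> (k div d) (k mod d) - \<nu> (k div d) (k mod d))" for k
  have "cq_state q d p (\<lambda>x. spec_mat d U (\<mu> x)) - cq_state q d p (\<lambda>x. spec_mat d U (\<nu> x)) =
      spec_mat (q * d) W \<eta>"
  proof (rule eq_matI)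
    fix u v assume "u < dim_row (spec_mat (q * d) W \<eta>)" "v < dim_col (spec_mat (q * d) W \<eta>)"
    then have uv: "u < q * d" "v < q * d" by (auto simp: spec_mat_def)
    then have d: "0 < d" by (cases d) auto
    have div: "u div d < q" using uv by (simp add: less_mult_imp_div_less)
    have "spec_mat (q * d) W \<eta> $$ (u, v) = (\<Sum>x<q. if x = u div d then if u div d = v div d then
        \<Sum>y<d. of_real (p x * (\<mu> x y - \<nu> x y)) * U (u mod d) y * cnj (U (v mod d) y) else 0 else 0)"
      unfolding spec_mat_index[OF uv] sum_lessThan_mult
      by (intro sum.cong refl) (auto simp: W_def \<eta>_def intro!: sum.neutral)
    also have "\<dots> = (if u div d = v div d then
        \<Sum>y<d. of_real (p (u div d) * (\<mu> (u div d) y - \<nu> (u div d) y)) * U (u mod d) y * cnj (U (v mod d) y) else 0)"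
      using div by simp
    also have "\<dots> = (cq_state q d p (\<lambda>x. spec_mat d U (\<mu> x)) - cq_state q d p (\<lambda>x. spec_mat d U (\<nu> x))) $$ (u, v)"
      using uv d
      by (simp add: cq_state_def spec_mat_index sum_distrib_left algebra_simps sum_subtractf)
    finally show "(cq_state q d p (\<lambda>x. spec_mat d U (\<mu> x)) - cq_state q d p (\<lambda>x. spec_mat d U (\<nu> x))) $$ (u, v) =
        spec_mat (q * d) W \<eta> $$ (u, v)" ..
  qed (simp_all add: cq_state_def spec_mat_def)
  moreover have "orthonormal (q * d) W"
    unfolding W_def by (rule orthonormal_blocks[OF U])
  ultimately have "trace_dist (cq_state q d p (\<lambda>x. spec_mat d U (\<mu> x))) (cq_state q d p (\<lambda>x. spec_mat d U (\<nu> x))) =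
      (\<Sum>k<q * d. \<bar>\<eta> k\<bar>) / 2"
    unfolding trace_dist_def by (simp add: trace_norm_spec_mat)
  also have "(\<Sum>k<q * d. \<bar>\<eta> k\<bar>) = (\<Sum>x<q. p x * (\<Sum>y<d. \<bar>\<mu> x y - \<nu> x y\<bar>))"
    unfolding sum_lessThan_mult sum_distrib_left
    using p by (intro sum.cong refl) (auto simp: \<eta>_def abs_mult)
  finally show ?thesis .
qed

text \<open>This removes the quantum part: what is left to find is a pair of stochastic kernels
  through an alphabet of size \<open>m\<close> that nearly preserve each spectrum. The factor 2 in
  \<open>err\<close> is the one between trace distance and \<open>L1\<close> distance.\<close>

lemma blind_protocol_product:
  assumes U: "orthonormal d U" and "0 < d"
    and h: "\<And>x s. 0 \<le> h x s" "\<And>x. x < d \<Longrightarrow> (\<Sum>s<m. h x s) = 1"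
    and g: "\<And>s y. 0 \<le> g s y" "\<And>s. s < m \<Longrightarrow> (\<Sum>y<d. g s y) = 1"
    and \<mu>: "\<And>x. x < q \<Longrightarrow> (\<Sum>y<d. \<mu> x y) = 1"
    and p: "\<And>x. x < q \<Longrightarrow> 0 \<le> p x" "(\<Sum>x<q. p x) = 1"
    and err: "\<And>x. x < q \<Longrightarrow>
      (\<Sum>y<d. \<bar>(\<Sum>s<m. \<Sum>k<d. \<mu> x k * h k s * g s y) - \<mu> x y\<bar>) \<le> 2 * \<epsilon>"
    and rate: "real (m ^ n) \<le> 2 powr (real n * R)"
  shows "blind_protocol n R \<epsilon> q d p (\<lambda>x. spec_mat d U (\<mu> x)) (m ^ n) (encoder n d m U h) (decoder n d m U g)"
proof -
  \<comment> \<open>The law of Bob's sample when the letter is \<open>x\<close>, hence the spectrum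
    of the state he produces.\<close>
  define \<nu> where "\<nu> x y = (\<Sum>s<m. \<Sum>k<d. \<mu> x k * h k s * g s y)" for x y
  define A where "A X X' c c' = (if X = X' then of_real (p X) * spec_mat d U (\<mu> X) $$ (c, c') else 0)"
    for X X' c c'
  have q: "0 < q" using p(2) by (cases q) auto
  have m: "0 < m" using h(2)[OF \<open>0 < d\<close>] by (cases m) auto
  define M where "M = copies q d n (cq_state q d p (\<lambda>x. spec_mat d U (\<mu> x)))"
  have M: "M $$ (X * d ^ n + C, X' * d ^ n + C') =
      (\<Prod>j<n. A (digit q n j X) (digit q n j X') (digit d n j C) (digit d n j C'))"
    if "X < q ^ n" "X' < q ^ n" "C < d ^ n" "C' < d ^ n" for X X' C C'
    unfolding M_def copies_index[OF that]
    using q \<open>0 < d\<close> by (intro prod.cong refl) (simp add: cq_state_index digit_less A_def)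
  have outcome: "outcome d U A X X' k = (if X = X' then of_real (p X * \<mu> X k) else 0)" if "k < d" for X X' k
  proof (cases "X = X'")
    case True
    have "outcome d U A X X' k = of_real (p X) *
        (\<Sum>\<alpha><d. \<Sum>\<beta><d. cnj (U \<alpha> k) * spec_mat d U (\<mu> X) $$ (\<alpha>, \<beta>) * U \<beta> k)"
      unfolding outcome_def sum_distrib_left using True by (intro sum.cong refl) (simp add: A_def)
    then show ?thesis
      using True by (simp add: spec_mat_expectation[OF U that])
  qed (simp add: outcome_def A_def)
  have recon: "reconstruction d m U h g A X X' c c' =
      (if X = X' then of_real (p X) * spec_mat d U (\<nu> X) $$ (c, c') else 0)"
    if "c < d" "c' < d" for X X' c c'
  proof (cases "X = X'")
    case True
    have "message d U h A X X' s = of_real (p X * (\<Sum>k<d. \<mu> X k * h k s))" for s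
      unfolding message_def sum_distrib_left of_real_sum
      using True by (intro sum.cong refl) (simp add: outcome)
    then have "reconstruction d m U h g A X X' c c' =
        (\<Sum>s<m. \<Sum>y<d. of_real (p X) * (of_real (\<Sum>k<d. \<mu> X k * h k s * g s y) * U c y * cnj (U c' y)))"
      unfolding reconstruction_def
      by (intro sum.cong refl) (simp flip: sum_distrib_right)
    also have "\<dots> = of_real (p X) *
        (\<Sum>y<d. \<Sum>s<m. of_real (\<Sum>k<d. \<mu> X k * h k s * g s y) * U c y * cnj (U c' y))"
      unfolding sum_distrib_left by (rule sum.swap)
    also have "\<dots> = of_real (p X) * spec_mat d U (\<nu> X) $$ (c, c')"
      unfolding spec_mat_index[OF that] \<nu>_def of_real_sum[of _ "{..<m}"] sum_distrib_right ..
    finally show ?thesis using True by simp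
  qed (simp add: reconstruction_def message_def outcome_def A_def)
  have \<nu>_sum: "(\<Sum>y<d. \<nu> x y) = 1" if "x < q" for x
  proof -
    have "(\<Sum>y<d. \<nu> x y) = (\<Sum>s<m. \<Sum>y<d. (\<Sum>k<d. \<mu> x k * h k s) * g s y)"
      unfolding \<nu>_def by (subst sum.swap) (simp add: sum_distrib_right)
    also have "\<dots> = (\<Sum>s<m. \<Sum>k<d. \<mu> x k * h k s)"
      using g(2) by (simp flip: sum_distrib_left)
    also have "\<dots> = (\<Sum>k<d. \<mu> x k * (\<Sum>s<m. h k s))"
      unfolding sum_distrib_left by (rule sum.swap)
    also have "\<dots> = 1"
      using h(2) \<mu>[OF that] by simp
    finally show ?thesis .
  qed
  have norm: "(\<Sum>x<q. \<Sum>c<d. reconstruction d m U h g A x x c c) = 1"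
  proof -
    have "(\<Sum>x<q. \<Sum>c<d. reconstruction d m U h g A x x c c) =
        (\<Sum>x<q. of_real (p x) * mat_trace (spec_mat d U (\<nu> x)))"
      by (intro sum.cong refl) (simp add: recon mat_trace_def sum_distrib_left spec_mat_carrier[THEN carrier_matD(1)])
    also have "\<dots> = of_real (\<Sum>x<q. p x)"
      by (simp add: trace_spec_mat[OF U] \<nu>_sum)
    finally show ?thesis using p by simp
  qed
  have marginal: "local_marginal q d n i (final_state q d n (m ^ n) (encoder n d m U h) (decoder n d m U g) M) =
      cq_state q d p (\<lambda>x. spec_mat d U (\<nu> x))" if i: "i < n" for i
  proof (rule eq_matI)
    fix u v
    assume "u < dim_row (cq_state q d p (\<lambda>x. spec_mat d U (\<nu> x)))"
      "v < dim_col (cq_state q d p (\<lambda>x. spec_mat d U (\<nu> x)))"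
    then have uv: "u < q * d" "v < q * d" by (auto simp: cq_state_def)
    define x c x' c' where xc: "x = u div d" "c = u mod d" "x' = v div d" "c' = v mod d"
    have less: "x < q" "x' < q" "c < d" "c' < d"
      using uv \<open>0 < d\<close> by (auto simp: xc less_mult_imp_div_less)
    have u: "u = x * d + c" "v = x' * d + c'" by (auto simp: xc)
    show "local_marginal q d n i (final_state q d n (m ^ n) (encoder n d m U h) (decoder n d m U g) M) $$ (u, v) =
        cq_state q d p (\<lambda>x. spec_mat d U (\<nu> x)) $$ (u, v)"
      unfolding u cq_state_index[OF less]
      using local_marginal_product[OF i final_state_product[OF M] norm less] recon[OF less(3,4)]
      by simp
  qed (simp_all add: local_marginal_def trace_out_def cq_state_def)
  have "trace_dist (cq_state q d p (\<lambda>x. spec_mat d U (\<nu> x))) (cq_state q d p (\<lambda>x. spec_mat d U (\<mu> x))) \<le> \<epsilon>"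
  proof -
    \<comment> \<open>Here the prior enters: the distance is a \<open>p\<close>-average of errors
      that are bounded letter by letter.\<close>
    have "(\<Sum>x<q. p x * (\<Sum>y<d. \<bar>\<nu> x y - \<mu> x y\<bar>)) \<le> (\<Sum>x<q. p x * (2 * \<epsilon>))"
      using p(1) err unfolding \<nu>_def by (intro sum_mono mult_left_mono) auto
    also have "\<dots> = 2 * \<epsilon>"
      using p(2) by (simp flip: sum_distrib_right)
    finally show ?thesis
      by (simp add: trace_dist_cq_state[OF U p(1)])
  qed
  then show ?thesis
    unfolding blind_protocol_def M_def[symmetric]
    using rate cptp_encoder[OF U \<open>0 < d\<close> h] cptp_decoder[OF U \<open>0 < d\<close> m g] classical_output_encoder
    by (simp add: marginal)
qed

subsection \<open>Rounding the likelihood ratio\<close>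

text \<open>The quotient of the two sums is a \<open>t\<close>-weighted mean of the ratios
  \<open>w x / t x\<close>, so it lies in the same interval of length \<delta> as each of them;
  multiplying by \<open>t y\<close> gives the bound.\<close>

lemma bucket_error:
  fixes w t :: "'a \<Rightarrow> real"
  assumes "finite S" and t: "\<And>x. x \<in> S \<Longrightarrow> 0 \<le> t x"
    and lower: "\<And>x. x \<in> S \<Longrightarrow> c * t x \<le> w x"
    and upper: "\<And>x. x \<in> S \<Longrightarrow> w x \<le> (c + \<delta>) * t x"
    and y: "y \<in> S"
  shows "\<bar>sum w S * t y / sum t S - w y\<bar> \<le> \<delta> * t y"
proof (cases "t y = 0")
  \<comment> \<open>Here the hypotheses squeeze \<open>w y\<close> to 0, and the resampled term
    vanishes with its factor \<open>t y\<close>.\<close>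
  case True
  then show ?thesis using lower[OF y] upper[OF y] by simp
next
  case False
  then have ty: "0 < t y" using t[OF y] by simp
  also have "t y \<le> sum t S"
    using assms(1) t y by (intro member_le_sum) auto
  finally have tot: "0 < sum t S" .
  have "c * sum t S \<le> sum w S" "sum w S \<le> (c + \<delta>) * sum t S"
    unfolding sum_distrib_left using lower upper by (auto intro!: sum_mono)
  moreover define r where "r = sum w S / sum t S"
  ultimately have "c \<le> r" "r \<le> c + \<delta>"
    using tot by (simp_all add: pos_le_divide_eq pos_divide_le_eq)
  then have "c * t y \<le> r * t y" "r * t y \<le> (c + \<delta>) * t y"
    using ty by (auto intro!: mult_right_mono)
  then have "\<bar>r * t y - w y\<bar> \<le> \<delta> * t y"
    using lower[OF y] upper[OF y] by (simp add: algebra_simps abs_le_iff)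
  then show ?thesis by (simp add: r_def)
qed

text \<open>Both bounds come from the same kernels: the local fact \<open>bound\<close> only asks
  for a lower end \<open>c s\<close> of the ratio \<open>w / t\<close> on each bucket, and it is
  used once for \<alpha> and once for \<beta>.\<close>

lemma bucket_channels:
  fixes \<alpha> \<beta> :: "nat \<Rightarrow> real"
  assumes pos: "\<And>x. x < d \<Longrightarrow> 0 \<le> \<alpha> x" "\<And>x. x < d \<Longrightarrow> 0 \<le> \<beta> x"
    and "0 < d" and \<delta>: "0 < \<delta>"
  shows "\<exists>m h g. real m \<le> 1 / \<delta> + 1 \<and>
    (\<forall>x s. 0 \<le> h x s) \<and> (\<forall>s y. 0 \<le> g s y) \<and>
    (\<forall>x<d. (\<Sum>s<m. h x s) = (1::real)) \<and> (\<forall>s<m. (\<Sum>y<d. g s y) = (1::real)) \<and>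
    (\<Sum>y<d. \<bar>(\<Sum>s<m. \<Sum>x<d. \<alpha> x * h x s * g s y) - \<alpha> y\<bar>) \<le> \<delta> * (\<Sum>y<d. \<alpha> y + \<beta> y) \<and>
    (\<Sum>y<d. \<bar>(\<Sum>s<m. \<Sum>x<d. \<beta> x * h x s * g s y) - \<beta> y\<bar>) \<le> \<delta> * (\<Sum>y<d. \<alpha> y + \<beta> y)"
proof -
  \<comment> \<open>Cut off at \<open>d\<close> to be nonnegative at every label, since the kernels
    have to be nonnegative everywhere.\<close>
  define t where "t x = (if x < d then \<alpha> x + \<beta> x else 0)" for x
  \<comment> \<open>If \<open>t x = 0\<close>, division gives 0 and \<open>x\<close> falls into
    bucket 0. This is harmless because then \<alpha> and \<beta> both vanish at
    \<open>x\<close>.\<close>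
  define q where "q x = (if x < d then \<alpha> x / t x else 0)" for x
  define f where "f x = nat \<lfloor>q x / \<delta>\<rfloor>" for x
  \<comment> \<open>The additional bucket accommodates ratios up to and including 1.\<close>
  define m where "m = nat \<lfloor>1 / \<delta>\<rfloor> + 1"
  define S where "S s = {x. x < d \<and> f x = s}" for s
  define h where "h x s = (if f x = s then 1 else 0 :: real)" for x s
  \<comment> \<open>A bucket without mass still needs a probability distribution, and the point mass
    at 0 is taken.\<close>
  define g where "g s y = (if sum t (S s) = 0 then (if y = 0 then 1 else 0)
    else if f y = s then t y / sum t (S s) else 0)" for s y
  have t: "0 \<le> t x" for x
    using pos[of x] by (simp add: t_def)
  have q: "0 \<le> q x" "q x \<le> 1" for x
    using pos[of x] t[of x] by (auto simp: q_def t_def divide_le_eq_1)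
  have f: "f x < m" for x
  proof -
    have "q x / \<delta> \<le> 1 / \<delta>" using q \<delta> by (simp add: divide_right_mono)
    then show ?thesis
      unfolding f_def m_def by (metis Suc_eq_plus1 floor_mono le_imp_less_Suc nat_mono)
  qed
  have S: "finite (S s)" "S s \<subseteq> {..<d}" for s
    by (auto simp: S_def)
  have tS: "0 \<le> sum t (S s)" for s
    by (simp add: sum_nonneg t)
  have g_sum: "(\<Sum>y<d. g s y) = 1" for s
  proof (cases "sum t (S s) = 0")
    case True
    then show ?thesis using \<open>0 < d\<close> by (simp add: g_def)
  next
    case False
    have "(\<Sum>y<d. g s y) = (\<Sum>y<d. if f y = s then t y / sum t (S s) else 0)"
      using False by (simp add: g_def)
    also have "\<dots> = (\<Sum>y\<in>S s. t y / sum t (S s))"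
      by (rule sum.mono_neutral_cong_right) (auto simp: S_def)
    also have "\<dots> = 1"
      using False by (simp flip: sum_divide_distrib)
    finally show ?thesis .
  qed
  have out: "(\<Sum>s<m. \<Sum>x<d. w x * h x s * g s y) = sum w (S (f y)) * t y / sum t (S (f y))"
    if w: "\<And>x. x < d \<Longrightarrow> 0 \<le> w x \<and> w x \<le> t x" and y: "y < d" for w y
  proof -
    have part: "(\<Sum>x<d. w x * h x s) = sum w (S s)" for s
    proof -
      have "(\<Sum>x<d. w x * h x s) = (\<Sum>x<d. if f x = s then w x else 0)"
        by (intro sum.cong refl) (simp add: h_def)
      also have "\<dots> = sum w (S s)"
        by (rule sum.mono_neutral_cong_right) (auto simp: S_def)
      finally show ?thesis .
    qed
    \<comment> \<open>Since \<open>w\<close> is dominated by \<open>t\<close>, the default row of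
      \<open>g\<close> on a bucket without mass is never weighted.\<close>
    have zero: "sum w (S s) = 0" if "sum t (S s) = 0" for s
    proof -
      have "sum w (S s) \<le> sum t (S s)" "0 \<le> sum w (S s)"
        using w by (auto intro!: sum_mono sum_nonneg simp: S_def)
      then show ?thesis using that by simp
    qed
    have "(\<Sum>s<m. \<Sum>x<d. w x * h x s * g s y) = (\<Sum>s<m. sum w (S s) * g s y)"
      by (simp add: part flip: sum_distrib_right)
    also have "\<dots> = (\<Sum>s<m. if f y = s then sum w (S s) * t y / sum t (S s) else 0)"
      by (intro sum.cong refl) (auto simp: g_def zero)
    also have "\<dots> = sum w (S (f y)) * t y / sum t (S (f y))"
      using f by simp
    finally show ?thesis .
  qed
  have bound: "(\<Sum>y<d. \<bar>(\<Sum>s<m. \<Sum>x<d. w x * h x s * g s y) - w y\<bar>) \<le> \<delta> * (\<Sum>y<d. \<alpha> y + \<beta> y)"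
    if w: "\<And>x. x < d \<Longrightarrow> 0 \<le> w x \<and> w x \<le> t x"
      and c: "\<And>x. x < d \<Longrightarrow> c (f x) * t x \<le> w x \<and> w x \<le> (c (f x) + \<delta>) * t x" for w c
  proof -
    have "(\<Sum>y<d. \<bar>(\<Sum>s<m. \<Sum>x<d. w x * h x s * g s y) - w y\<bar>) \<le> (\<Sum>y<d. \<delta> * t y)"
    proof (rule sum_mono)
      fix y assume "y \<in> {..<d}"
      then have y: "y < d" by simp
      have eq: "(\<Sum>s<m. \<Sum>x<d. w x * h x s * g s y) = sum w (S (f y)) * t y / sum t (S (f y))"
        using w y by (rule out)
      show "\<bar>(\<Sum>s<m. \<Sum>x<d. w x * h x s * g s y) - w y\<bar> \<le> \<delta> * t y"
        unfolding eq
      proof (rule bucket_error[of "S (f y)" t "c (f y)" w \<delta> y])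
        fix x assume "x \<in> S (f y)"
        then have "x < d" "f x = f y" by (auto simp: S_def)
        then show "c (f y) * t x \<le> w x" "w x \<le> (c (f y) + \<delta>) * t x"
          using c[of x] by auto
      qed (use S t y in \<open>auto simp: S_def\<close>)
    qed
    also have "\<dots> = \<delta> * (\<Sum>y<d. \<alpha> y + \<beta> y)"
      unfolding sum_distrib_left by (intro sum.cong refl) (simp add: t_def)
    finally show ?thesis .
  qed
  have bucket: "real (f x) * \<delta> * t x \<le> \<alpha> x" "\<alpha> x \<le> (real (f x) * \<delta> + \<delta>) * t x" if x: "x < d" for x
  proof -
    have "real (f x) \<le> q x / \<delta>" "q x / \<delta> \<le> real (f x) + 1"
      using q[of x] \<delta> unfolding f_def by (simp_all add: of_nat_nat)
    then have "real (f x) * \<delta> \<le> q x" "q x \<le> real (f x) * \<delta> + \<delta>"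
      using \<delta> by (simp_all add: field_simps)
    then have "real (f x) * \<delta> * t x \<le> q x * t x" "q x * t x \<le> (real (f x) * \<delta> + \<delta>) * t x"
      using t by (auto intro!: mult_right_mono)
    moreover have "q x * t x = \<alpha> x"
      using x pos[of x] by (auto simp: q_def t_def add_nonneg_eq_0_iff)
    ultimately show "real (f x) * \<delta> * t x \<le> \<alpha> x" "\<alpha> x \<le> (real (f x) * \<delta> + \<delta>) * t x"
      by simp_all
  qed
  have "real m \<le> 1 / \<delta> + 1"
    using \<delta> unfolding m_def by (simp add: of_nat_nat)
  moreover have "0 \<le> h x s" "0 \<le> g s y" for x s y
    using t tS by (auto simp: h_def g_def)
  moreover have "(\<Sum>s<m. h x s) = 1" for x
    using f by (simp add: h_def)
  moreover have "(\<Sum>y<d. \<bar>(\<Sum>s<m. \<Sum>x<d. \<alpha> x * h x s * g s y) - \<alpha> y\<bar>) \<le> \<delta> * (\<Sum>y<d. \<alpha> y + \<beta> y)"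
    by (rule bound[where c = "\<lambda>s. real s * \<delta>"]) (use pos bucket in \<open>auto simp: t_def\<close>)
  moreover have "(\<Sum>y<d. \<bar>(\<Sum>s<m. \<Sum>x<d. \<beta> x * h x s * g s y) - \<beta> y\<bar>) \<le> \<delta> * (\<Sum>y<d. \<alpha> y + \<beta> y)"
  \<comment> \<open>The ratio of \<beta> is one minus that of \<alpha>, so its interval on bucket
    \<open>s\<close> is the mirror image, whose lower end comes from the upper end for
    \<alpha>.\<close>
  proof (rule bound[where c = "\<lambda>s. 1 - (real s * \<delta> + \<delta>)"])
    fix x assume x: "x < d"
    then show "0 \<le> \<beta> x \<and> \<beta> x \<le> t x" using pos by (simp add: t_def)
    have "\<beta> x = t x - \<alpha> x" using x by (simp add: t_def)
    then show "(1 - (real (f x) * \<delta> + \<delta>)) * t x \<le> \<beta> x \<and> \<beta> x \<le> (1 - (real (f x) * \<delta> + \<delta>) + \<delta>) * t x"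
      using bucket[OF x] by (simp add: algebra_simps)
  qed
  ultimately show ?thesis
    using g_sum by (intro exI[of _ m] exI[of _ h] exI[of _ g]) simp
qed

text \<open>From \<open>d / \<gamma>\<close> at least 2 the iterated logarithm is nonnegative, and
  \<open>1 / \<delta> + 1\<close> is at most \<open>2 / \<delta>\<close>, whose logarithm is
  \<open>1 + log 2 (1 / \<delta>)\<close>. This bounds one copy; the \<open>n\<close>-th power gives
  the message of the whole block.\<close>

lemma power_le_powr_rate:
  assumes "0 < \<delta>" "\<delta> < 1 / 2" "0 < \<gamma>" "\<gamma> < 1" "2 \<le> d" and m: "real m \<le> 1 / \<delta> + 1"
  shows "real (m ^ n) \<le> 2 powr (real n * (2 * log 2 (log 2 (real d / \<gamma>)) + 2 * log 2 (1 / \<delta>) + 3))"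
proof -
  let ?R = "2 * log 2 (log 2 (real d / \<gamma>)) + 2 * log 2 (1 / \<delta>) + 3"
  have "2 * \<gamma> \<le> 2" "2 \<le> real d" using assms by auto
  then have "2 \<le> real d / \<gamma>"
    using assms by (simp add: pos_le_divide_eq)
  then have "1 \<le> log 2 (real d / \<gamma>)"
    using le_log_iff[of 2 "real d / \<gamma>" 1] by simp
  then have "0 \<le> log 2 (log 2 (real d / \<gamma>))"
    by simp
  moreover have \<delta>: "1 \<le> 1 / \<delta>" using assms by simp
  have "0 \<le> log 2 (1 / \<delta>)"
    using zero_le_log_cancel_iff[of 2 "1 / \<delta>"] \<delta> assms by simp
  ultimately have R: "1 + log 2 (1 / \<delta>) \<le> ?R" by simp
  have "real m \<le> 2 * (1 / \<delta>)" using m \<delta> by simp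
  also have "\<dots> = 2 powr (1 + log 2 (1 / \<delta>))"
    using assms by (simp add: powr_add)
  also have "\<dots> \<le> 2 powr ?R"
    using R by (intro powr_mono) auto
  finally have "real m ^ n \<le> (2 powr ?R) ^ n"
    by (intro power_mono) auto
  then show ?thesis
    by (simp add: powr_realpow[symmetric] powr_powr mult.commute)
qed

theorem theorem5:
  fixes n d :: nat and \<delta> \<gamma> :: real and \<rho> \<sigma> :: "complex mat"
  assumes "n \<ge> 1" and "0 < \<delta>" and "\<delta> < 1/2" and "0 < \<gamma>" and "\<gamma> < 1" and "d \<ge> 2"
    and "state d \<rho>" and "state d \<sigma>" and "\<rho> * \<sigma> = \<sigma> * \<rho>"
  shows "\<exists>t E D. \<forall>p :: nat \<Rightarrow> real. p 0 \<ge> 0 \<and> p 1 \<ge> 0 \<and> p 0 + p 1 = 1 \<longrightarrow>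
    blind_protocol n (2 * log 2 (log 2 (real d / \<gamma>)) + 2 * log 2 (1 / \<delta>) + 3) (\<delta> + \<gamma>)
      2 d p (\<lambda>x. if x = 0 then \<rho> else \<sigma>) t E D"
proof -
  have psd: "psd d \<rho>" "psd d \<sigma>" and trace: "mat_trace \<rho> = 1" "mat_trace \<sigma> = 1"
    using \<open>state d \<rho>\<close> \<open>state d \<sigma>\<close> by (auto simp: state_def)
  have d: "0 < d" using \<open>d \<ge> 2\<close> by simp
  obtain U \<alpha> \<beta> where U: "orthonormal d U" and spec: "\<rho> = spec_mat d U \<alpha>" "\<sigma> = spec_mat d U \<beta>"
    and nonneg: "\<And>k. k < d \<Longrightarrow> 0 \<le> \<alpha> k" "\<And>k. k < d \<Longrightarrow> 0 \<le> \<beta> k"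
    using simultaneous_diagonalization[OF psd \<open>\<rho> * \<sigma> = \<sigma> * \<rho>\<close>] by blast
  have sum1: "(\<Sum>k<d. \<alpha> k) = 1" "(\<Sum>k<d. \<beta> k) = 1"
    using trace unfolding spec trace_spec_mat[OF U] by (simp_all only: of_real_eq_1_iff)
  obtain m h g where m: "real m \<le> 1 / \<delta> + 1"
    and h: "\<And>x s. 0 \<le> h x s" "\<And>x. x < d \<Longrightarrow> (\<Sum>s<m. h x s) = (1::real)"
    and g: "\<And>s y. 0 \<le> g s y" "\<And>s. s < m \<Longrightarrow> (\<Sum>y<d. g s y) = (1::real)"
    and err: "(\<Sum>y<d. \<bar>(\<Sum>s<m. \<Sum>x<d. \<alpha> x * h x s * g s y) - \<alpha> y\<bar>) \<le> \<delta> * (\<Sum>y<d. \<alpha> y + \<beta> y)"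
      "(\<Sum>y<d. \<bar>(\<Sum>s<m. \<Sum>x<d. \<beta> x * h x s * g s y) - \<beta> y\<bar>) \<le> \<delta> * (\<Sum>y<d. \<alpha> y + \<beta> y)"
    using bucket_channels[of d \<alpha> \<beta> \<delta>] nonneg d \<open>0 < \<delta>\<close> by auto
  define \<mu> where "\<mu> x = (if x = 0 then \<alpha> else \<beta>)" for x :: nat
  have ensemble: "(\<lambda>x. if x = 0 then \<rho> else \<sigma>) = (\<lambda>x::nat. spec_mat d U (\<mu> x))"
    by (auto simp: spec \<mu>_def)
  have "(\<Sum>y<d. \<alpha> y + \<beta> y) = 2"
    by (simp add: sum.distrib sum1)
  \<comment> \<open>The total mass 2 of the two spectra matches the factor 2 that
    \<open>blind_protocol_product\<close> expects, and \<open>2 * \<delta>\<close> is at most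
    \<open>2 * (\<delta> + \<gamma>)\<close>.\<close>
  then have "(\<Sum>y<d. \<bar>(\<Sum>s<m. \<Sum>k<d. \<mu> x k * h k s * g s y) - \<mu> x y\<bar>) \<le> 2 * (\<delta> + \<gamma>)" for x
    using err \<open>0 < \<gamma>\<close> by (cases "x = 0") (simp_all add: \<mu>_def)
  note err' = this
  have "blind_protocol n (2 * log 2 (log 2 (real d / \<gamma>)) + 2 * log 2 (1 / \<delta>) + 3) (\<delta> + \<gamma>)
      2 d p (\<lambda>x. if x = 0 then \<rho> else \<sigma>) (m ^ n) (encoder n d m U h) (decoder n d m U g)"
    if "p 0 \<ge> 0" "p 1 \<ge> 0" "p 0 + p 1 = 1" for p :: "nat \<Rightarrow> real"
    unfolding ensemble
  proof (rule blind_protocol_product[OF U d h g])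
    show "(\<Sum>x<2. p x) = 1" using that by (simp add: numeral_2_eq_2)
    show "0 \<le> p x" if "x < 2" for x
      using \<open>x < 2\<close> \<open>p 0 \<ge> 0\<close> \<open>p 1 \<ge> 0\<close> by (auto simp: less_2_cases_iff)
    show "(\<Sum>y<d. \<mu> x y) = 1" for x by (simp add: \<mu>_def sum1)
    show "real (m ^ n) \<le> 2 powr (real n * (2 * log 2 (log 2 (real d / \<gamma>)) + 2 * log 2 (1 / \<delta>) + 3))"
      using assms m by (intro power_le_powr_rate)
  qed (use err' in auto)
  then show ?thesis by blast
qed

end
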